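(* Let $R$ be any ring. (i) If there is a family of propositional tautologies for which Hilbert-like $\mathrm{IPS}_R$ proofs require super-polynomial size, then $\mathsf{VNP}_R\neq\mathsf{VP}_R$; likewise, a super-polynomial lower bound on constant-free Hilbert-like $\mathrm{IPS}_R$ proofs of some family of tautologies implies $\mathsf{VNP}^0_R\neq\mathsf{VP}^0_R$. (ii) If there is a family of propositional tautologies for which Polynomial Calculus proofs require a super-polynomial number of lines, then the Permanent versus Determinant Conjecture holds, i.e. $\mathsf{VNP}\neq\mathsf{VP}_{ws}$.
   Context: IPS (Ideal Proof System): for polynomials $F_1,\dots,F_m\in R[x_1,\dots,x_n]$, an IPS certificate of unsatisfiability of $F_1=\dots=F_m=0$ is a polynomial $C(\vec x,\vec y)\in R[x_1,\dots,x_n,y_1,\dots,y_m]$ ($y_i$ new "placeholder" variables) with $C(\vec x,\vec 0)=0$ and $C(\vec x,F_1(\vec x),\dots,F_m(\vec x))=1$. It is Hilbert-like if it has the form $\sum_i y_iG_i(\vec x)$. An $\mathrm{IPS}_R$ proof is an algebraic circuit over $R$ with inputs $\vec x,\vec y$ computing an IPS certificate; its size is its circuit size (families of proofs are by default required to have polynomial degree). A constant-free circuit uses only the constants $0,1,-1$. A tautology is handled through the unsatisfiable CNF $\kappa_1\wedge\dots\wedge\kappa_m$ it corresponds to: each clause $\kappa$ is translated into the polynomial obtained as the product over its literals of $1-x$ for a positive literal $x$ and $x$ for a negative literal $\neg x$ (so a $0/1$ assignment satisfies $\kappa$ iff the polynomial vanishes), and the system also contains $x_i^2-x_i$ for every variable;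 an IPS proof of the tautology is an IPS proof of unsatisfiability of this system. $\mathsf{VP}_R$: families $(f_n)$ of polynomials with $\mathrm{poly}(n)$ variables and degree computable by $\mathrm{poly}(n)$-size algebraic circuits over $R$. $\mathsf{VNP}_R$: families $g_n(\vec x)=\sum_{\vec e\in\{0,1\}^{\mathrm{poly}(n)}}f_n(\vec e,\vec x)$ with $(f_n)\in\mathsf{VP}_R$ and $g_n$ of polynomial degree and number of variables. $\mathsf{VP}^0_R,\mathsf{VNP}^0_R$ are the same with constant-free circuits. A circuit of fan-in at most 2 is weakly skew if for every multiplication gate, one of its two input subcircuits is connected to the rest of the circuit only through that gate; $\mathsf{VP}_{ws}$ is the class of families computed by polynomial-size weakly skew circuits (equivalently, p-projections of the determinant). Polynomial Calculus (number-of-lines measure): a derivation of $1$ from $F_1,\dots,F_m$ where each line is one of the $F_i$, or $\alpha G+\beta H$ for earlier lines $G,H$ and field elements $\alpha,\beta$, or $x_iG$ for an earlier line $G$ and a variable $x_i$; its size is its number of lines. *)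

theory Defs
  imports Main "HOL-Library.Poly_Mapping"
begin

type_synonym ('v, 'a) mpoly = "('v \<Rightarrow>\<^sub>0 nat) \<Rightarrow>\<^sub>0 'a"

definition PVar :: "'v \<Rightarrow> ('v, 'a::comm_ring_1) mpoly" where
  "PVar v = Poly_Mapping.single (Poly_Mapping.single v 1) 1"

definition PConst :: "'a::comm_ring_1 \<Rightarrow> ('v, 'a) mpoly" where
  "PConst c = Poly_Mapping.single 0 c"

definition mpoly_vars :: "('v, 'a::zero) mpoly \<Rightarrow> 'v set" where
  "mpoly_vars p = \<Union> (Poly_Mapping.keys ` Poly_Mapping.keys p)"

definition mon_deg :: "('v \<Rightarrow>\<^sub>0 nat) \<Rightarrow> nat" where
  "mon_deg m = (\<Sum>v\<in>Poly_Mapping.keys m. Poly_Mapping.lookup m v)"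

definition mpoly_deg :: "('v, 'a::zero) mpoly \<Rightarrow> nat" where
  "mpoly_deg p = Max (insert 0 (mon_deg ` Poly_Mapping.keys p))"

definition msubst :: "('v \<Rightarrow> ('w, 'a::comm_ring_1) mpoly) \<Rightarrow> ('v, 'a) mpoly \<Rightarrow> ('w, 'a) mpoly" where
  "msubst \<sigma> p = (\<Sum>m\<in>Poly_Mapping.keys p.
      PConst (Poly_Mapping.lookup p m) *
      (\<Prod>v\<in>Poly_Mapping.keys m. \<sigma> v ^ Poly_Mapping.lookup m v))"

datatype ('v, 'a) gate = Inp 'v | Cst 'a | Add nat nat | Mul nat nat

fun gate_args :: "('v, 'a) gate \<Rightarrow> nat set" where
  "gate_args (Inp v) = {}"
| "gate_args (Cst c) = {}"
| "gate_args (Add i j) = {i, j}"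
| "gate_args (Mul i j) = {i, j}"

definition circ_wf :: "('v, 'a) gate list \<Rightarrow> bool" where
  "circ_wf gs \<longleftrightarrow> gs \<noteq> [] \<and> (\<forall>k<length gs. \<forall>i\<in>gate_args (gs ! k). i < k)"

fun gate_val :: "('v \<Rightarrow> 'b::comm_ring_1) \<Rightarrow> ('a \<Rightarrow> 'b) \<Rightarrow> 'b list \<Rightarrow> ('v, 'a) gate \<Rightarrow> 'b" where
  "gate_val \<sigma> \<kappa> vs (Inp v) = \<sigma> v"
| "gate_val \<sigma> \<kappa> vs (Cst c) = \<kappa> c"
| "gate_val \<sigma> \<kappa> vs (Add i j) = vs ! i + vs ! j"
| "gate_val \<sigma> \<kappa> vs (Mul i j) = vs ! i * vs ! j"

definition circ_vals :: "('v \<Rightarrow> 'b::comm_ring_1) \<Rightarrow> ('a \<Rightarrow> 'b) \<Rightarrow> ('v, 'a) gate list \<Rightarrow> 'b list" where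
  "circ_vals \<sigma> \<kappa> gs = foldl (\<lambda>vs g. vs @ [gate_val \<sigma> \<kappa> vs g]) [] gs"

definition circ_poly :: "('v, 'a::comm_ring_1) gate list \<Rightarrow> ('v, 'a) mpoly" where
  "circ_poly gs = last (circ_vals PVar PConst gs)"

definition constant_free :: "('v, 'a::comm_ring_1) gate list \<Rightarrow> bool" where
  "constant_free gs \<longleftrightarrow> (\<forall>c. Cst c \<in> set gs \<longrightarrow> c \<in> {0, 1, -1})"

inductive in_subcirc :: "('v, 'a) gate list \<Rightarrow> nat \<Rightarrow> nat \<Rightarrow> bool" for gs i where
  root: "in_subcirc gs i i"
| step: "in_subcirc gs i j \<Longrightarrow> j < length gs \<Longrightarrow> a \<in> gate_args (gs ! j) \<Longrightarrow> in_subcirc gs i a"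

text \<open>the subcircuit at input i of multiplication gate k (other input j) is connected to the
  rest of the circuit only through gate k\<close>
definition isolated_input :: "('v, 'a) gate list \<Rightarrow> nat \<Rightarrow> nat \<Rightarrow> nat \<Rightarrow> bool" where
  "isolated_input gs k i j \<longleftrightarrow> \<not> in_subcirc gs i j \<and>
     (\<forall>h<length gs. h \<noteq> k \<longrightarrow> \<not> in_subcirc gs i h \<longrightarrow>
        (\<forall>a\<in>gate_args (gs ! h). \<not> in_subcirc gs i a))"

definition weakly_skew :: "('v, 'a) gate list \<Rightarrow> bool" where
  "weakly_skew gs \<longleftrightarrow> (\<forall>k<length gs. \<forall>i j. gs ! k = Mul i j \<longrightarrow>
      isolated_input gs k i j \<or> isolated_input gs k j i)"

definition poly_bounded :: "(nat \<Rightarrow> nat) \<Rightarrow> bool" where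
  "poly_bounded h \<longleftrightarrow> (\<exists>c k. \<forall>n. h n \<le> c * n ^ k + c)"

definition inVP :: "bool \<Rightarrow> (nat \<Rightarrow> (nat, 'a::comm_ring_1) mpoly) \<Rightarrow> bool" where
  "inVP cf f \<longleftrightarrow> (\<exists>c k. \<forall>n.
      mpoly_vars (f n) \<subseteq> {..< c * n ^ k + c} \<and> mpoly_deg (f n) \<le> c * n ^ k + c \<and>
      (\<exists>gs :: (nat, 'a) gate list. circ_wf gs \<and> (cf \<longrightarrow> constant_free gs) \<and>
          length gs \<le> c * n ^ k + c \<and> circ_poly gs = f n))"

definition VP_class :: "bool \<Rightarrow> (nat \<Rightarrow> (nat, 'a::comm_ring_1) mpoly) set" where
  "VP_class cf = {f. inVP cf f}"

text \<open>VNP: g_n(x) = sum over e in {0,1}^m(n) of f_n(e, x); the first m(n) variables of f_n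
  are the summation variables, variable m(n)+i of f_n is x_i\<close>
definition inVNP :: "bool \<Rightarrow> (nat \<Rightarrow> (nat, 'a::comm_ring_1) mpoly) \<Rightarrow> bool" where
  "inVNP cf g \<longleftrightarrow> (\<exists>f m. inVP cf f \<and> poly_bounded m \<and>
      (\<exists>c k. \<forall>n. mpoly_vars (g n) \<subseteq> {..< c * n ^ k + c} \<and> mpoly_deg (g n) \<le> c * n ^ k + c) \<and>
      (\<forall>n. g n = (\<Sum>S\<in>Pow {..< m n}.
          msubst (\<lambda>i. if i < m n then (if i \<in> S then 1 else 0) else PVar (i - m n)) (f n))))"

definition VNP_class :: "bool \<Rightarrow> (nat \<Rightarrow> (nat, 'a::comm_ring_1) mpoly) set" where
  "VNP_class cf = {g. inVNP cf g}"

definition inVPws :: "(nat \<Rightarrow> (nat, 'a::comm_ring_1) mpoly) \<Rightarrow> bool" where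
  "inVPws f \<longleftrightarrow> (\<exists>c k. \<forall>n.
      mpoly_vars (f n) \<subseteq> {..< c * n ^ k + c} \<and> mpoly_deg (f n) \<le> c * n ^ k + c \<and>
      (\<exists>gs :: (nat, 'a) gate list. circ_wf gs \<and> weakly_skew gs \<and>
          length gs \<le> c * n ^ k + c \<and> circ_poly gs = f n))"

definition VPws_class :: "(nat \<Rightarrow> (nat, 'a::comm_ring_1) mpoly) set" where
  "VPws_class = {f. inVPws f}"

section \<open>CNFs (tautologies via their negations) and their polynomial translation\<close>

type_synonym lit = "nat \<times> bool"   \<comment> \<open>(variable, True = positive literal)\<close>
type_synonym clause = "lit list"
type_synonym cnf = "clause list"

definition unsat_cnf :: "cnf \<Rightarrow> bool" where
  "unsat_cnf \<tau> \<longleftrightarrow> (\<forall>a :: nat \<Rightarrow> bool. \<exists>\<kappa>\<in>set \<tau>. \<not> (\<exists>(v, b)\<in>set \<kappa>. a v = b))"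

definition cnf_vars :: "cnf \<Rightarrow> nat set" where
  "cnf_vars \<tau> = fst ` \<Union> (set ` set \<tau>)"

definition cnf_size :: "cnf \<Rightarrow> nat" where
  "cnf_size \<tau> = length \<tau> + sum_list (map length \<tau>) +
     (if cnf_vars \<tau> = {} then 0 else Max (cnf_vars \<tau>) + 1)"

fun lit_poly :: "(nat \<Rightarrow> 'p::comm_ring_1) \<Rightarrow> lit \<Rightarrow> 'p" where
  "lit_poly \<iota> (v, True) = 1 - \<iota> v"
| "lit_poly \<iota> (v, False) = \<iota> v"

definition clause_poly :: "(nat \<Rightarrow> 'p::comm_ring_1) \<Rightarrow> clause \<Rightarrow> 'p" where
  "clause_poly \<iota> \<kappa> = prod_list (map (lit_poly \<iota>) \<kappa>)"

definition cnf_axioms :: "(nat \<Rightarrow> 'p::comm_ring_1) \<Rightarrow> cnf \<Rightarrow> 'p list" where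
  "cnf_axioms \<iota> \<tau> = map (clause_poly \<iota>) \<tau> @
     map (\<lambda>v. \<iota> v ^ 2 - \<iota> v) (sorted_list_of_set (cnf_vars \<tau>))"

datatype ivar = XV nat | YV nat

definition is_IPS_cert :: "(ivar, 'a::comm_ring_1) mpoly list \<Rightarrow> (ivar, 'a) mpoly \<Rightarrow> bool" where
  "is_IPS_cert Fs C \<longleftrightarrow>
     mpoly_vars C \<subseteq> range XV \<union> YV ` {..< length Fs} \<and>
     msubst (\<lambda>v. case v of XV i \<Rightarrow> PVar (XV i) | YV j \<Rightarrow> 0) C = 0 \<and>
     msubst (\<lambda>v. case v of XV i \<Rightarrow> PVar (XV i) | YV j \<Rightarrow> Fs ! j) C = 1"

definition hilbert_like :: "nat \<Rightarrow> (ivar, 'a::comm_ring_1) mpoly \<Rightarrow> bool" where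
  "hilbert_like m C \<longleftrightarrow> (\<exists>G :: nat \<Rightarrow> (ivar, 'a) mpoly.
     (\<forall>j. mpoly_vars (G j) \<subseteq> range XV) \<and> C = (\<Sum>j<m. PVar (YV j) * G j))"

definition hilbert_IPS_proof :: "bool \<Rightarrow> cnf \<Rightarrow> (ivar, 'a::comm_ring_1) gate list \<Rightarrow> bool" where
  "hilbert_IPS_proof cf \<tau> gs \<longleftrightarrow> circ_wf gs \<and> (cf \<longrightarrow> constant_free gs) \<and>
     is_IPS_cert (cnf_axioms (\<lambda>v. PVar (XV v)) \<tau>) (circ_poly gs) \<and>
     hilbert_like (length (cnf_axioms (\<lambda>v. PVar (XV v) :: (ivar, 'a) mpoly) \<tau>)) (circ_poly gs)"

definition PC_derivation :: "(nat, 'a::field) mpoly list \<Rightarrow> (nat, 'a) mpoly list \<Rightarrow> bool" where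
  "PC_derivation Fs ls \<longleftrightarrow> ls \<noteq> [] \<and> last ls = 1 \<and>
     (\<forall>k<length ls. ls ! k \<in> set Fs \<or>
        (\<exists>i<k. \<exists>j<k. \<exists>\<alpha> \<beta>. ls ! k = PConst \<alpha> * ls ! i + PConst \<beta> * ls ! j) \<or>
        (\<exists>i<k. \<exists>v. ls ! k = PVar v * ls ! i))"

definition PC_proof :: "cnf \<Rightarrow> (nat, 'a::field) mpoly list \<Rightarrow> bool" where
  "PC_proof \<tau> ls \<longleftrightarrow> PC_derivation (cnf_axioms PVar \<tau>) ls"

definition taut_family :: "(nat \<Rightarrow> cnf) \<Rightarrow> bool" where
  "taut_family \<tau> \<longleftrightarrow> (\<forall>n. unsat_cnf (\<tau> n)) \<and> poly_bounded (\<lambda>n. cnf_size (\<tau> n))"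

end

theory Submission
  imports Defs
begin

text \<open>Expand \<open>1\<close> as the sum over all 0/1 points \<open>S\<close> of the point polynomials
  \<open>D\<^sub>S = (\<Prod>v\<in>S. x\<^sub>v) * (\<Prod>v\<notin>S. 1 - x\<^sub>v)\<close> and let \<open>\<kappa>\<close> be the first clause falsified by \<open>S\<close>. Then
  \<open>D\<^sub>S = \<kappa> * D\<^sub>S + (1 - \<kappa>) * D\<^sub>S\<close>, and the second summand lies in the ideal of the \<open>x\<^sub>v\<^sup>2 - x\<^sub>v\<close> with
  explicit coefficients. Since being the first falsified clause is given by a small formula in the
  bits of \<open>S\<close>, every unsatisfiable CNF has a Hilbert-like certificate that is an exponential sum of
  small constant-free formulas. If \<open>VNP = VP\<close>, these certificates have small circuits. If
  \<open>VNP = VP\<^sub>w\<^sub>s\<close>, they have small weakly skew circuits; setting one placeholder to \<open>1\<close> and the others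
  to \<open>0\<close> yields weakly skew circuits for the coefficients of the axioms, and Polynomial Calculus
  multiplies a line by the value of a weakly skew circuit with one line per gate.\<close>

section \<open>Substitution, degree and variables of polynomials\<close>

lemma poly_mapping_eq_sum_single:
  "p = (\<Sum>m\<in>Poly_Mapping.keys p. Poly_Mapping.single m (Poly_Mapping.lookup p m))"
  by (rule poly_mapping_eqI)
     (auto simp: lookup_sum lookup_single when_def in_keys_iff sum.delta)

lemma PConst_zero [simp]: "PConst 0 = 0"
  and PConst_one [simp]: "PConst 1 = 1"
  by (simp_all add: PConst_def)

lemma PConst_add: "PConst (a + b) = PConst a + PConst b"
  by (simp add: PConst_def single_add)

lemma PConst_mult: "PConst (a * b) = PConst a * PConst b"
  by (simp add: PConst_def mult_single)

lemma PConst_uminus: "PConst (- a) = - PConst a"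
  by (simp add: PConst_def single_uminus)

text \<open>Monomials outside the support have coefficient 0, so polynomials with different supports
  can be summed over one common index set.\<close>

lemma msubst_superset:
  assumes "finite K" "Poly_Mapping.keys p \<subseteq> K"
  shows "msubst \<sigma> p = (\<Sum>m\<in>K. PConst (Poly_Mapping.lookup p m) *
      (\<Prod>v\<in>Poly_Mapping.keys m. \<sigma> v ^ Poly_Mapping.lookup m v))"
  unfolding msubst_def using assms
  by (intro sum.mono_neutral_left) (auto simp: in_keys_iff)

lemma msubst_zero [simp]: "msubst \<sigma> 0 = 0"
  by (simp add: msubst_def)

lemma msubst_add: "msubst \<sigma> (p + q) = msubst \<sigma> p + msubst \<sigma> q"
proof -
  let ?K = "Poly_Mapping.keys p \<union> Poly_Mapping.keys q"
  have "Poly_Mapping.keys (p + q) \<subseteq> ?K" by (rule keys_add)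
  then show ?thesis
    by (simp add: msubst_superset[of ?K] lookup_add PConst_add algebra_simps sum.distrib)
qed

lemma msubst_sum: "msubst \<sigma> (\<Sum>i\<in>A. f i) = (\<Sum>i\<in>A. msubst \<sigma> (f i))"
  by (induction A rule: infinite_finite_induct) (auto simp: msubst_add)

lemma msubst_single: "msubst \<sigma> (Poly_Mapping.single m c) =
   PConst c * (\<Prod>v\<in>Poly_Mapping.keys m. \<sigma> v ^ Poly_Mapping.lookup m v)"
  by (simp add: msubst_superset[of "{m}"])

lemma prod_power_keys_add:
  fixes m m' :: "'v \<Rightarrow>\<^sub>0 nat" and \<sigma> :: "'v \<Rightarrow> 'r::comm_monoid_mult"
  shows "(\<Prod>v\<in>Poly_Mapping.keys (m + m'). \<sigma> v ^ Poly_Mapping.lookup (m + m') v) =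
    (\<Prod>v\<in>Poly_Mapping.keys m. \<sigma> v ^ Poly_Mapping.lookup m v) *
    (\<Prod>v\<in>Poly_Mapping.keys m'. \<sigma> v ^ Poly_Mapping.lookup m' v)"
proof -
  let ?K = "Poly_Mapping.keys m \<union> Poly_Mapping.keys m'"
  have *: "(\<Prod>v\<in>Poly_Mapping.keys n. \<sigma> v ^ Poly_Mapping.lookup n v) =
      (\<Prod>v\<in>?K. \<sigma> v ^ Poly_Mapping.lookup n v)" if "Poly_Mapping.keys n \<subseteq> ?K" for n
    using that by (intro prod.mono_neutral_left) (auto simp: in_keys_iff)
  \<comment> \<open>Exponents are natural numbers, so nothing cancels and the support of the sum is
    the whole union.\<close>
  have "Poly_Mapping.keys (m + m') = ?K"
    by (auto simp: in_keys_iff lookup_add)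
  then show ?thesis
    by (simp add: *[OF Un_upper1] *[OF Un_upper2] lookup_add power_add prod.distrib)
qed

text \<open>Both sides are biadditive, so two monomials suffice. The sums have free
  \<open>K\<close>, \<open>L\<close>, \<open>f\<close>, \<open>g\<close> at first, since the
  monomial expansion of \<open>p\<close> mentions \<open>p\<close> again and is therefore folded,
  not unfolded.\<close>

lemma msubst_mult: "msubst \<sigma> (p * q) = msubst \<sigma> p * msubst \<sigma> q"
proof -
  have "msubst \<sigma> (Poly_Mapping.single m c * Poly_Mapping.single m' c') =
      msubst \<sigma> (Poly_Mapping.single m c) * msubst \<sigma> (Poly_Mapping.single m' c')" for m m' c c'
    by (simp add: mult_single msubst_single prod_power_keys_add PConst_mult mult_ac)
  then have "msubst \<sigma> ((\<Sum>m\<in>K. Poly_Mapping.single m (f m)) * (\<Sum>m\<in>L. Poly_Mapping.single m (g m))) =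
      msubst \<sigma> (\<Sum>m\<in>K. Poly_Mapping.single m (f m)) * msubst \<sigma> (\<Sum>m\<in>L. Poly_Mapping.single m (g m))"
    for K L f g
    by (simp add: sum_product msubst_sum)
  from this[of "Poly_Mapping.lookup p" "Poly_Mapping.keys p" "Poly_Mapping.lookup q" "Poly_Mapping.keys q"]
  show ?thesis
    unfolding poly_mapping_eq_sum_single[symmetric] .
qed

lemma msubst_PConst [simp]: "msubst \<sigma> (PConst c) = PConst c"
  unfolding PConst_def by (simp only: msubst_single) (simp add: PConst_def)

lemma msubst_one [simp]: "msubst \<sigma> 1 = 1"
  using msubst_PConst[of \<sigma> 1] by simp

lemma msubst_uminus: "msubst \<sigma> (- p) = - msubst \<sigma> p"
  using msubst_add[of \<sigma> p "- p"] by (simp add: eq_neg_iff_add_eq_0 add.commute)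

lemma msubst_PVar [simp]: "msubst \<sigma> (PVar v) = \<sigma> v"
  unfolding PVar_def by (simp only: msubst_single) simp

section \<open>Variables and degree of polynomials\<close>

lemma mpoly_vars_zero [simp]: "mpoly_vars 0 = {}"
  by (simp add: mpoly_vars_def)

lemma mpoly_vars_one [simp]: "mpoly_vars (1 :: ('v, 'a::comm_ring_1) mpoly) = {}"
  by (simp add: mpoly_vars_def)

lemma mpoly_vars_PVar [simp]: "mpoly_vars (PVar v :: ('v, 'a::comm_ring_1) mpoly) = {v}"
  by (simp add: mpoly_vars_def PVar_def)

lemma mpoly_vars_uminus [simp]:
  "mpoly_vars (- p :: ('v, 'a::comm_ring_1) mpoly) = mpoly_vars p"
  by (auto simp: mpoly_vars_def in_keys_iff)

lemma mpoly_vars_add: "mpoly_vars (p + q) \<subseteq> mpoly_vars p \<union> mpoly_vars q"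
  unfolding mpoly_vars_def using keys_add[of p q] by blast

lemma mpoly_vars_mult:
  "mpoly_vars (p * q :: ('v, 'a::comm_ring_1) mpoly) \<subseteq> mpoly_vars p \<union> mpoly_vars q"
proof
  fix v assume "v \<in> mpoly_vars (p * q)"
  then obtain m where m: "m \<in> Poly_Mapping.keys (p * q)" "v \<in> Poly_Mapping.keys m"
    by (auto simp: mpoly_vars_def)
  from m(1) obtain a b where "m = a + b" "a \<in> Poly_Mapping.keys p" "b \<in> Poly_Mapping.keys q"
    using keys_mult[of p q] by blast
  with m(2) show "v \<in> mpoly_vars p \<union> mpoly_vars q"
    using keys_add[of a b] by (fastforce simp: mpoly_vars_def)
qed

lemma mpoly_vars_sum: "mpoly_vars (\<Sum>i\<in>A. f i) \<subseteq> (\<Union>i\<in>A. mpoly_vars (f i))"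
  using mpoly_vars_add
  by (induction A rule: infinite_finite_induct) (simp, simp, fastforce)

lemma mon_deg_add: "mon_deg (a + b) = mon_deg a + mon_deg b"
  unfolding mon_deg_def by (rule setsum_keys_plus_distrib) simp_all

lemma mpoly_deg_le_iff: "mpoly_deg p \<le> d \<longleftrightarrow> (\<forall>m\<in>Poly_Mapping.keys p. mon_deg m \<le> d)"
  by (simp add: mpoly_deg_def)

lemma mon_deg_le_mpoly_deg: "m \<in> Poly_Mapping.keys p \<Longrightarrow> mon_deg m \<le> mpoly_deg p"
  using mpoly_deg_le_iff by blast

lemma mpoly_deg_zero [simp]: "mpoly_deg 0 = 0"
  by (simp add: mpoly_deg_def)

lemma mpoly_deg_one [simp]: "mpoly_deg (1 :: ('v, 'a::comm_ring_1) mpoly) = 0"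
  by (simp add: mpoly_deg_def mon_deg_def)

lemma mpoly_deg_PVar [simp]: "mpoly_deg (PVar v :: ('v, 'a::comm_ring_1) mpoly) = 1"
  by (simp add: mpoly_deg_def mon_deg_def PVar_def)

lemma mpoly_deg_uminus [simp]: "mpoly_deg (- p :: ('v, 'a::comm_ring_1) mpoly) = mpoly_deg p"
proof -
  have "Poly_Mapping.keys (- p) = Poly_Mapping.keys p"
    by (auto simp: in_keys_iff)
  then show ?thesis by (simp add: mpoly_deg_def)
qed

lemma mpoly_deg_add:
  assumes "mpoly_deg p \<le> d" "mpoly_deg q \<le> d"
  shows "mpoly_deg (p + q) \<le> d"
  using assms keys_add[of p q] by (auto simp: mpoly_deg_le_iff)

lemma mpoly_deg_sum:
  assumes "\<And>i. i \<in> A \<Longrightarrow> mpoly_deg (f i) \<le> d"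
  shows "mpoly_deg (\<Sum>i\<in>A. f i) \<le> d"
  using assms by (induction A rule: infinite_finite_induct) (auto intro!: mpoly_deg_add)

lemma mpoly_deg_mult:
  "mpoly_deg (p * q :: ('v, 'a::comm_ring_1) mpoly) \<le> mpoly_deg p + mpoly_deg q"
  unfolding mpoly_deg_le_iff
proof
  fix m assume "m \<in> Poly_Mapping.keys (p * q)"
  then obtain a b where "m = a + b" "a \<in> Poly_Mapping.keys p" "b \<in> Poly_Mapping.keys q"
    using keys_mult[of p q] by blast
  then show "mon_deg m \<le> mpoly_deg p + mpoly_deg q"
    by (simp add: mon_deg_add add_mono mon_deg_le_mpoly_deg)
qed

section \<open>Polynomially bounded functions\<close>

text \<open>As \<open>n + 1\<close> is never 0, bounds \<open>c * (n + 1) ^ k\<close> need no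
  additive constant and are monotone in \<open>k\<close>; closure under sums and products is proved
  in this form.\<close>

lemma poly_boundedI:
  assumes "\<And>n::nat. h n \<le> c * (n + 1) ^ k"
  shows "poly_bounded h"
  unfolding poly_bounded_def
proof (intro exI allI)
  fix n :: nat
  \<comment> \<open>For positive \<open>n\<close> this comes from \<open>n + 1 \<le> 2 * n\<close>;
    the summand \<open>2 ^ k\<close> covers \<open>n = 0\<close>.\<close>
  have "(n + 1) ^ k \<le> 2 ^ k * n ^ k + 2 ^ k"
  proof (cases "n = 0")
    case False
    then have "(n + 1) ^ k \<le> (2 * n) ^ k" by (intro power_mono) auto
    then show ?thesis by (simp add: power_mult_distrib)
  qed (cases k; simp)
  then have "c * (n + 1) ^ k \<le> (c * 2 ^ k) * n ^ k + c * 2 ^ k"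
    by (metis add_mult_distrib2 mult.assoc mult_le_mono2)
  with assms show "h n \<le> (c * 2 ^ k) * n ^ k + c * 2 ^ k"
    using le_trans by blast
qed

lemma poly_boundedE:
  assumes "poly_bounded h"
  obtains c k where "\<forall>n. h n \<le> c * (n + 1) ^ k"
proof -
  obtain c k where ck: "\<And>n. h n \<le> c * n ^ k + c"
    using assms by (auto simp: poly_bounded_def)
  have "h n \<le> (2 * c) * (n + 1) ^ k" for n
  proof -
    have "c * n ^ k \<le> c * (n + 1) ^ k" "c * 1 \<le> c * (n + 1) ^ k"
      using power_mono[of n "n + 1" k] by (simp_all del: power_Suc)
    moreover have "(2 * c) * (n + 1) ^ k = c * (n + 1) ^ k + c * (n + 1) ^ k" by algebra
    ultimately show ?thesis using ck[of n] by linarith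
  qed
  then show ?thesis using that by blast
qed

lemma poly_bounded_mono: "poly_bounded h \<Longrightarrow> (\<And>n. f n \<le> h n) \<Longrightarrow> poly_bounded f"
  unfolding poly_bounded_def by (meson le_trans)

lemma poly_bounded_const: "poly_bounded (\<lambda>n. a)"
  by (rule poly_boundedI[of _ a 0]) simp

lemma poly_bounded_power: "poly_bounded (\<lambda>n. n ^ k)"
  unfolding poly_bounded_def by (intro exI[of _ 1] exI[of _ k]) simp

lemma poly_bounded_add:
  assumes "poly_bounded f" "poly_bounded g"
  shows "poly_bounded (\<lambda>n. f n + g n)"
proof -
  obtain c k where f: "\<forall>n. f n \<le> c * (n + 1) ^ k" using assms(1) by (rule poly_boundedE)
  obtain d l where g: "\<forall>n. g n \<le> d * (n + 1) ^ l" using assms(2) by (rule poly_boundedE)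
  have "f n + g n \<le> (c + d) * (n + 1) ^ (k + l)" for n
  proof -
    have "c * (n + 1) ^ k \<le> c * (n + 1) ^ (k + l)" "d * (n + 1) ^ l \<le> d * (n + 1) ^ (k + l)"
      by (intro mult_le_mono2 power_increasing; simp)+
    with f[rule_format, of n] g[rule_format, of n] show ?thesis
      unfolding add_mult_distrib by linarith
  qed
  then show ?thesis by (rule poly_boundedI)
qed

lemma poly_bounded_mult:
  assumes "poly_bounded f" "poly_bounded g"
  shows "poly_bounded (\<lambda>n. f n * g n)"
proof -
  obtain c k where f: "\<forall>n. f n \<le> c * (n + 1) ^ k" using assms(1) by (rule poly_boundedE)
  obtain d l where g: "\<forall>n. g n \<le> d * (n + 1) ^ l" using assms(2) by (rule poly_boundedE)
  have "f n * g n \<le> (c * d) * (n + 1) ^ (k + l)" for n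
    using mult_mono[OF f[rule_format, of n] g[rule_format, of n]] by (simp add: power_add mult_ac)
  then show ?thesis by (rule poly_boundedI)
qed

section \<open>Circuits and formulas\<close>

lemma circ_vals_Nil [simp]: "circ_vals \<sigma> \<kappa> [] = []"
  by (simp add: circ_vals_def)

lemma circ_vals_snoc:
  "circ_vals \<sigma> \<kappa> (gs @ [g]) = circ_vals \<sigma> \<kappa> gs @ [gate_val \<sigma> \<kappa> (circ_vals \<sigma> \<kappa> gs) g]"
  by (simp add: circ_vals_def)

lemma length_circ_vals [simp]: "length (circ_vals \<sigma> \<kappa> gs) = length gs"
  by (induction gs rule: rev_induct) (simp_all add: circ_vals_snoc)

lemma take_circ_vals_append: "take (length gs) (circ_vals \<sigma> \<kappa> (gs @ hs)) = circ_vals \<sigma> \<kappa> gs"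
  by (induction hs rule: rev_induct) (simp_all add: circ_vals_snoc flip: append_assoc)

lemma nth_circ_vals_append:
  "k < length gs \<Longrightarrow> circ_vals \<sigma> \<kappa> (gs @ hs) ! k = circ_vals \<sigma> \<kappa> gs ! k"
  by (metis nth_take take_circ_vals_append)

lemma circ_vals_eq_Nil_iff [simp]: "circ_vals \<sigma> \<kappa> gs = [] \<longleftrightarrow> gs = []"
  by (metis length_0_conv length_circ_vals)

lemma gate_val_cong:
  assumes "\<And>i. i \<in> gate_args g \<Longrightarrow> vs ! i = ws ! i"
  shows "gate_val \<sigma> \<kappa> vs g = gate_val \<sigma> \<kappa> ws g"
  using assms by (cases g) auto

text \<open>Well-formedness without nonemptiness, so that inductions on gate lists can start from
  the empty list.\<close>

definition args_below :: "('v, 'a) gate list \<Rightarrow> bool" where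
  "args_below gs \<longleftrightarrow> (\<forall>k<length gs. \<forall>i\<in>gate_args (gs ! k). i < k)"

lemma circ_wf_iff: "circ_wf gs \<longleftrightarrow> gs \<noteq> [] \<and> args_below gs"
  by (simp add: circ_wf_def args_below_def)

lemma args_below_Nil [simp]: "args_below []"
  by (simp add: args_below_def)

lemma args_below_snoc:
  "args_below (gs @ [g]) \<longleftrightarrow> args_below gs \<and> (\<forall>i\<in>gate_args g. i < length gs)"
  by (auto simp: args_below_def nth_append less_Suc_eq)

text \<open>Arguments point backwards, so values appended later do not affect a gate, and its
  defining equation holds in the final list as well.\<close>

lemma nth_circ_vals:
  assumes "args_below gs" "k < length gs"
  shows "circ_vals \<sigma> \<kappa> gs ! k = gate_val \<sigma> \<kappa> (circ_vals \<sigma> \<kappa> gs) (gs ! k)"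
  using assms
proof (induction gs rule: rev_induct)
  case (snoc g gs)
  let ?vs = "circ_vals \<sigma> \<kappa> (gs @ [g])"
  have *: "gate_val \<sigma> \<kappa> (circ_vals \<sigma> \<kappa> gs) h = gate_val \<sigma> \<kappa> ?vs h"
    if "\<forall>i\<in>gate_args h. i < length gs" for h
    using that by (intro gate_val_cong) (simp add: nth_circ_vals_append)
  show ?case
  proof (cases "k = length gs")
    case True
    have "?vs ! k = gate_val \<sigma> \<kappa> (circ_vals \<sigma> \<kappa> gs) g"
      using True by (simp add: circ_vals_snoc nth_append)
    with True snoc.prems * show ?thesis by (simp add: args_below_snoc)
  next
    case False
    with snoc.prems have k: "k < length gs" "args_below gs" by (auto simp: args_below_snoc)
    then have "\<forall>i\<in>gate_args (gs ! k). i < length gs"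
      by (force simp: args_below_def)
    with k snoc.IH * show ?thesis by (simp add: nth_circ_vals_append nth_append)
  qed
qed simp

text \<open>Every gate is a ring operation, hence commutes with \<open>h\<close>; backward arguments
  ensure that only existing positions are looked up.\<close>

lemma circ_vals_hom:
  assumes "args_below gs"
    and add: "\<And>p q. h (p + q) = h p + h q" and mult: "\<And>p q. h (p * q) = h p * h q"
  shows "map h (circ_vals \<sigma> \<kappa> gs) = circ_vals (\<lambda>v. h (\<sigma> v)) (\<lambda>c. h (\<kappa> c)) gs"
  using assms(1)
proof (induction gs rule: rev_induct)
  case (snoc g gs)
  then have IH: "map h (circ_vals \<sigma> \<kappa> gs) = circ_vals (\<lambda>v. h (\<sigma> v)) (\<lambda>c. h (\<kappa> c)) gs"
    and g: "\<forall>i\<in>gate_args g. i < length gs"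
    by (auto simp: args_below_snoc)
  have "h (gate_val \<sigma> \<kappa> (circ_vals \<sigma> \<kappa> gs) g) =
      gate_val (\<lambda>v. h (\<sigma> v)) (\<lambda>c. h (\<kappa> c)) (map h (circ_vals \<sigma> \<kappa> gs)) g"
    using g by (cases g) (simp_all add: add mult)
  with IH show ?case by (simp add: circ_vals_snoc)
qed simp

text \<open>Substitution into the output becomes evaluation of the same gates at other inputs, so
  the circuit itself never has to be rebuilt.\<close>

lemma msubst_circ_poly:
  assumes "circ_wf gs"
  shows "msubst \<sigma> (circ_poly gs) = last (circ_vals \<sigma> PConst gs)"
proof -
  have "map (msubst \<sigma>) (circ_vals PVar PConst gs) =
      circ_vals (\<lambda>v. msubst \<sigma> (PVar v)) (\<lambda>c. msubst \<sigma> (PConst c)) gs"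
    using assms by (intro circ_vals_hom) (auto simp: circ_wf_iff msubst_add msubst_mult)
  then have "last (map (msubst \<sigma>) (circ_vals PVar PConst gs)) = last (circ_vals \<sigma> PConst gs)"
    by simp
  then show ?thesis
    using assms by (simp add: circ_poly_def circ_wf_iff last_map)
qed

section \<open>Renaming the inputs of a circuit\<close>

fun rename_gate :: "('v \<Rightarrow> 'w) \<Rightarrow> ('v, 'a) gate \<Rightarrow> ('w, 'a) gate" where
  "rename_gate \<rho> (Inp v) = Inp (\<rho> v)"
| "rename_gate \<rho> (Cst c) = Cst c"
| "rename_gate \<rho> (Add i j) = Add i j"
| "rename_gate \<rho> (Mul i j) = Mul i j"

lemma gate_args_rename_gate [simp]: "gate_args (rename_gate \<rho> g) = gate_args g"
  by (cases g) auto

lemma circ_wf_rename [simp]: "circ_wf (map (rename_gate \<rho>) gs) \<longleftrightarrow> circ_wf gs"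
  by (simp add: circ_wf_def)

lemma constant_free_rename:
  assumes "constant_free gs"
  shows "constant_free (map (rename_gate \<rho>) gs)"
proof -
  have "Cst c \<in> set gs" if "Cst c \<in> rename_gate \<rho> ` set gs" for c
  proof -
    from that obtain g where "g \<in> set gs" "Cst c = rename_gate \<rho> g" by auto
    moreover from this(2) have "g = Cst c" by (cases g) auto
    ultimately show ?thesis by simp
  qed
  with assms show ?thesis by (auto simp: constant_free_def)
qed

lemma circ_vals_rename:
  "circ_vals \<sigma> \<kappa> (map (rename_gate \<rho>) gs) = circ_vals (\<sigma> \<circ> \<rho>) \<kappa> gs"
proof (induction gs rule: rev_induct)
  case (snoc g gs)
  then show ?case by (cases g) (simp_all add: circ_vals_snoc)
qed simp

lemma circ_poly_rename:
  assumes "circ_wf gs"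
  shows "circ_poly (map (rename_gate \<rho>) gs) = msubst (PVar \<circ> \<rho>) (circ_poly gs)"
  unfolding msubst_circ_poly[OF assms] by (simp add: circ_poly_def circ_vals_rename)

section \<open>Constant-free formulas and their compilation to circuits\<close>

datatype 'v formula =
    FVar 'v | FZero | FOne | FNegOne
  | FPlus "'v formula" "'v formula" | FTimes "'v formula" "'v formula"

fun feval :: "('v \<Rightarrow> 'r::comm_ring_1) \<Rightarrow> 'v formula \<Rightarrow> 'r" where
  "feval \<sigma> (FVar v) = \<sigma> v"
| "feval \<sigma> FZero = 0"
| "feval \<sigma> FOne = 1"
| "feval \<sigma> FNegOne = - 1"
| "feval \<sigma> (FPlus \<phi> \<psi>) = feval \<sigma> \<phi> + feval \<sigma> \<psi>"
| "feval \<sigma> (FTimes \<phi> \<psi>) = feval \<sigma> \<phi> * feval \<sigma> \<psi>"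

fun fsize :: "'v formula \<Rightarrow> nat" where
  "fsize (FPlus \<phi> \<psi>) = fsize \<phi> + fsize \<psi> + 1"
| "fsize (FTimes \<phi> \<psi>) = fsize \<phi> + fsize \<psi> + 1"
| "fsize _ = 1"

fun fvars :: "'v formula \<Rightarrow> 'v set" where
  "fvars (FVar v) = {v}"
| "fvars (FPlus \<phi> \<psi>) = fvars \<phi> \<union> fvars \<psi>"
| "fvars (FTimes \<phi> \<psi>) = fvars \<phi> \<union> fvars \<psi>"
| "fvars _ = {}"

lemma feval_cong: "(\<And>v. v \<in> fvars \<phi> \<Longrightarrow> \<sigma> v = \<tau> v) \<Longrightarrow> feval \<sigma> \<phi> = feval \<tau> \<phi>"
  by (induction \<phi>) auto

lemma msubst_feval: "msubst \<tau> (feval \<sigma> \<phi>) = feval (msubst \<tau> \<circ> \<sigma>) \<phi>"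
  by (induction \<phi>) (auto simp: msubst_add msubst_mult msubst_uminus)

lemma mpoly_vars_feval: "mpoly_vars (feval \<sigma> \<phi>) \<subseteq> (\<Union>v\<in>fvars \<phi>. mpoly_vars (\<sigma> v))"
proof (induction \<phi>)
  case (FPlus \<phi> \<psi>)
  then show ?case using mpoly_vars_add[of "feval \<sigma> \<phi>" "feval \<sigma> \<psi>"] by auto
next
  case (FTimes \<phi> \<psi>)
  then show ?case using mpoly_vars_mult[of "feval \<sigma> \<phi>" "feval \<sigma> \<psi>"] by auto
qed auto

text \<open>In a tree every use of a leaf is counted, so size bounds degree; in a circuit with
  sharing, repeated squaring would break this. All polynomial degree bounds for the certificate come
  from here.\<close>

lemma mpoly_deg_feval:
  assumes "\<And>v. mpoly_deg (\<sigma> v) \<le> 1"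
  shows "mpoly_deg (feval \<sigma> \<phi>) \<le> fsize \<phi>"
proof (induction \<phi>)
  case (FTimes \<phi> \<psi>)
  then show ?case using mpoly_deg_mult[of "feval \<sigma> \<phi>" "feval \<sigma> \<psi>"] by simp
qed (use assms in \<open>auto intro!: mpoly_deg_add\<close>)

text \<open>Gate arguments are absolute positions, so the code of a subformula depends on the gates
  already emitted; hence the prefix \<open>gs\<close>.\<close>

definition cf_extension ::
    "('v, 'a::comm_ring_1) gate list \<Rightarrow> ('v, 'a) gate list \<Rightarrow> ('v, 'a) mpoly \<Rightarrow> bool" where
  "cf_extension gs hs p \<longleftrightarrow> hs \<noteq> [] \<and> args_below (gs @ hs) \<and> constant_free (gs @ hs) \<and>
     last (circ_vals PVar PConst (gs @ hs)) = p"

lemma cf_extension_leaf: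
  assumes "args_below gs" "constant_free gs" "gate_args g = {}" "\<forall>c. g = Cst c \<longrightarrow> c \<in> {0, 1, -1}"
  shows "cf_extension gs [g] (gate_val PVar PConst [] g)"
proof -
  have "gate_val PVar PConst (circ_vals PVar PConst gs) g = gate_val PVar PConst [] g"
    using assms(3) by (intro gate_val_cong) auto
  then show ?thesis
    using assms by (auto simp: cf_extension_def args_below_snoc circ_vals_snoc constant_free_def)
qed

text \<open>The operands are the last gates of the blocks \<open>as\<close> and \<open>bs\<close>,
  at positions \<open>i\<close> and \<open>j\<close>; appending \<open>bs\<close> does not change
  the value at \<open>i\<close>.\<close>

lemma cf_extension_binary:
  fixes gs :: "('v, 'a::comm_ring_1) gate list"
  assumes as: "cf_extension gs as p" and bs: "cf_extension (gs @ as) bs q"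
  defines "i \<equiv> length (gs @ as) - 1" and "j \<equiv> length ((gs @ as) @ bs) - 1"
  shows "cf_extension gs (as @ bs @ [Add i j]) (p + q)"
    and "cf_extension gs (as @ bs @ [Mul i j]) (p * q)"
proof -
  have i: "i < length (gs @ as)" and j: "j < length ((gs @ as) @ bs)"
    using as bs by (simp_all add: i_def j_def cf_extension_def)
  have "circ_vals PVar PConst (gs @ as) ! i = p"
    using as last_conv_nth[of "circ_vals PVar PConst (gs @ as)"] by (simp add: i_def cf_extension_def)
  then have p: "circ_vals PVar PConst ((gs @ as) @ bs) ! i = p"
    using i nth_circ_vals_append by metis
  have q: "circ_vals PVar PConst ((gs @ as) @ bs) ! j = q"
    using bs last_conv_nth[of "circ_vals PVar PConst ((gs @ as) @ bs)"]
    by (simp add: j_def cf_extension_def)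
  have "cf_extension gs (as @ bs @ [g]) (gate_val PVar PConst (circ_vals PVar PConst ((gs @ as) @ bs)) g)"
    if "gate_args g = {i, j}" for g
  proof -
    have "args_below (((gs @ as) @ bs) @ [g])"
      unfolding args_below_snoc using bs i j that by (auto simp: cf_extension_def)
    moreover have "constant_free (((gs @ as) @ bs) @ [g])"
      using bs that by (auto simp: cf_extension_def constant_free_def)
    moreover have "last (circ_vals PVar PConst (((gs @ as) @ bs) @ [g])) =
        gate_val PVar PConst (circ_vals PVar PConst ((gs @ as) @ bs)) g"
      unfolding circ_vals_snoc by simp
    ultimately show ?thesis by (simp add: cf_extension_def)
  qed
  from this[of "Add i j"] this[of "Mul i j"] p q
  show "cf_extension gs (as @ bs @ [Add i j]) (p + q)"
    and "cf_extension gs (as @ bs @ [Mul i j]) (p * q)"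
    by simp_all
qed

text \<open>One gate per node; the prefix is arbitrary in the induction because the second operand
  is compiled behind the first.\<close>

lemma formula_circuit_extend:
  fixes \<phi> :: "'v formula" and gs :: "('v, 'a::comm_ring_1) gate list"
  assumes "args_below gs" "constant_free gs"
  shows "\<exists>hs. length hs \<le> fsize \<phi> \<and> cf_extension gs hs (feval PVar \<phi>)"
  using assms
proof (induction \<phi> arbitrary: gs)
  case (FPlus \<phi> \<psi>)
  then obtain as where as: "length as \<le> fsize \<phi>" "cf_extension gs as (feval PVar \<phi>)" by blast
  with FPlus.IH(2) obtain bs where
    "length bs \<le> fsize \<psi>" "cf_extension (gs @ as) bs (feval PVar \<psi>)"
    unfolding cf_extension_def by blast
  with as show ?case by (auto dest!: cf_extension_binary(1)[OF as(2)] intro!: exI)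
next
  case (FTimes \<phi> \<psi>)
  then obtain as where as: "length as \<le> fsize \<phi>" "cf_extension gs as (feval PVar \<phi>)" by blast
  with FTimes.IH(2) obtain bs where
    "length bs \<le> fsize \<psi>" "cf_extension (gs @ as) bs (feval PVar \<psi>)"
    unfolding cf_extension_def by blast
  with as show ?case by (auto dest!: cf_extension_binary(2)[OF as(2)] intro!: exI)
next
  case (FVar v)
  then show ?case by (intro exI[of _ "[Inp v]"]) (use cf_extension_leaf[of gs "Inp v"] in simp)
next
  case FZero
  then show ?case by (intro exI[of _ "[Cst 0]"]) (use cf_extension_leaf[of gs "Cst 0"] in simp)
next
  case FOne
  then show ?case by (intro exI[of _ "[Cst 1]"]) (use cf_extension_leaf[of gs "Cst 1"] in simp)
next
  case FNegOne
  then show ?case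
    by (intro exI[of _ "[Cst (- 1)]"]) (use cf_extension_leaf[of gs "Cst (- 1)"] in \<open>simp add: PConst_uminus\<close>)
qed

lemma formula_circuit:
  obtains gs :: "('v, 'a::comm_ring_1) gate list"
  where "circ_wf gs" "constant_free gs" "length gs \<le> fsize \<phi>" "circ_poly gs = feval PVar \<phi>"
  using formula_circuit_extend[of "[] :: ('v, 'a) gate list" \<phi>]
  by (auto simp: circ_wf_iff circ_poly_def constant_free_def cf_extension_def)

section \<open>The formula of the certificate\<close>

fun fsum :: "'v formula list \<Rightarrow> 'v formula" where
  "fsum [] = FZero"
| "fsum (\<phi> # \<phi>s) = FPlus \<phi> (fsum \<phi>s)"

fun fprod :: "'v formula list \<Rightarrow> 'v formula" where
  "fprod [] = FOne"
| "fprod (\<phi> # \<phi>s) = FTimes \<phi> (fprod \<phi>s)"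

definition fnot :: "'v formula \<Rightarrow> 'v formula" where
  "fnot \<phi> = FPlus FOne (FTimes FNegOne \<phi>)"

lemma feval_fsum: "feval \<sigma> (fsum \<phi>s) = sum_list (map (feval \<sigma>) \<phi>s)"
  by (induction \<phi>s) auto

lemma feval_fprod: "feval \<sigma> (fprod \<phi>s) = prod_list (map (feval \<sigma>) \<phi>s)"
  by (induction \<phi>s) auto

lemma feval_fnot [simp]: "feval \<sigma> (fnot \<phi>) = 1 - feval \<sigma> \<phi>"
  by (simp add: fnot_def)

lemma fvars_fsum [simp]: "fvars (fsum \<phi>s) = \<Union> (fvars ` set \<phi>s)"
  by (induction \<phi>s) auto

lemma fvars_fprod [simp]: "fvars (fprod \<phi>s) = \<Union> (fvars ` set \<phi>s)"
  by (induction \<phi>s) auto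

lemma fvars_fnot [simp]: "fvars (fnot \<phi>) = fvars \<phi>"
  by (simp add: fnot_def)

lemma fsize_fsum:
  assumes "\<And>\<phi>. \<phi> \<in> set \<phi>s \<Longrightarrow> fsize \<phi> \<le> B" "length \<phi>s \<le> l"
  shows "fsize (fsum \<phi>s) \<le> l * (B + 1) + 1"
proof -
  have "fsize (fsum \<phi>s) \<le> length \<phi>s * (B + 1) + 1"
    using assms(1) by (induction \<phi>s) fastforce+
  with assms(2) show ?thesis
    by (meson add_le_mono1 le_trans mult_le_mono1)
qed

lemma fsize_fprod:
  assumes "\<And>\<phi>. \<phi> \<in> set \<phi>s \<Longrightarrow> fsize \<phi> \<le> B" "length \<phi>s \<le> l"
  shows "fsize (fprod \<phi>s) \<le> l * (B + 1) + 1"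
proof -
  have "fsize (fprod \<phi>s) \<le> length \<phi>s * (B + 1) + 1"
    using assms(1) by (induction \<phi>s) fastforce+
  with assms(2) show ?thesis
    by (meson add_le_mono1 le_trans mult_le_mono1)
qed

lemma fsize_fnot [simp]: "fsize (fnot \<phi>) = fsize \<phi> + 4"
  by (simp add: fnot_def)

text \<open>A bound on the indices, not a count of the occurring variables: the summation variables
  in \<open>inVNP\<close> form an initial segment. It is a summand of \<open>cnf_size\<close>, hence
  polynomially bounded.\<close>

definition num_vars :: "cnf \<Rightarrow> nat" where
  "num_vars \<tau> = (if cnf_vars \<tau> = {} then 0 else Max (cnf_vars \<tau>) + 1)"

lemma finite_cnf_vars [simp]: "finite (cnf_vars \<tau>)"
  by (simp add: cnf_vars_def)

lemma cnf_vars_subset: "cnf_vars \<tau> \<subseteq> {..<num_vars \<tau>}"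
  by (auto simp: num_vars_def less_Suc_eq_le)

lemma length_cnf_axioms: "length (cnf_axioms \<iota> \<tau>) = length \<tau> + card (cnf_vars \<tau>)"
  by (simp add: cnf_axioms_def)

lemma cnf_size_bounds:
  shows "num_vars \<tau> \<le> cnf_size \<tau>" "length \<tau> \<le> cnf_size \<tau>"
    and "\<kappa> \<in> set \<tau> \<Longrightarrow> length \<kappa> \<le> cnf_size \<tau>"
    and "length (cnf_axioms \<iota> \<tau>) \<le> 2 * cnf_size \<tau>"
proof -
  show N: "num_vars \<tau> \<le> cnf_size \<tau>" and m: "length \<tau> \<le> cnf_size \<tau>"
    by (simp_all add: cnf_size_def num_vars_def)
  show "length \<kappa> \<le> cnf_size \<tau>" if "\<kappa> \<in> set \<tau>"
    using member_le_sum_list[of "length \<kappa>" "map length \<tau>"] that by (simp add: cnf_size_def)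
  have "card (cnf_vars \<tau>) \<le> num_vars \<tau>"
    using card_mono[OF _ cnf_vars_subset] by fastforce
  with N m show "length (cnf_axioms \<iota> \<tau>) \<le> 2 * cnf_size \<tau>"
    unfolding length_cnf_axioms by linarith
qed

text \<open>Variable layout for a CNF whose variables lie below \<open>N\<close>: the formulas below use variable \<open>v < N\<close>
  for the summation bit of \<open>x\<^sub>v\<close>, variable \<open>N + v\<close> for \<open>x\<^sub>v\<close> itself and variable \<open>2 * N + j\<close> for
  the placeholder \<open>y\<^sub>j\<close>.\<close>

fun lit_formula :: "nat \<Rightarrow> lit \<Rightarrow> nat formula" where
  "lit_formula a (v, True) = fnot (FVar (a + v))"
| "lit_formula a (v, False) = FVar (a + v)"

definition clause_formula :: "nat \<Rightarrow> clause \<Rightarrow> nat formula" where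
  "clause_formula a \<kappa> = fprod (map (lit_formula a) \<kappa>)"

text \<open>The factor of the point polynomial at \<open>v\<close>: it is \<open>x_v\<close> if the
  bit is 1 and \<open>1 - x_v\<close> if the bit is 0.\<close>

definition select_formula :: "nat \<Rightarrow> nat \<Rightarrow> nat formula" where
  "select_formula N v =
     FPlus (FTimes (FVar v) (FVar (N + v))) (FTimes (fnot (FVar v)) (fnot (FVar (N + v))))"

definition point_formula :: "nat \<Rightarrow> nat list \<Rightarrow> nat formula" where
  "point_formula N vs = fprod (map (select_formula N) vs)"

text \<open>Offset 0 evaluates the clauses at the summation bits, where a clause polynomial is 1 if
  the clause is falsified and 0 otherwise; so this is the indicator that clause \<open>i\<close> is
  the first falsified one.\<close>

definition first_formula :: "cnf \<Rightarrow> nat \<Rightarrow> nat formula" where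
  "first_formula \<tau> i = FTimes (clause_formula 0 (\<tau> ! i))
     (fprod (map (\<lambda>\<kappa>. fnot (clause_formula 0 \<kappa>)) (take i \<tau>)))"

text \<open>The coefficient of \<open>x\<^sub>v\<^sup>2 - x\<^sub>v\<close> in \<open>D * (1 - \<kappa>)\<close> for the point polynomial \<open>D\<close>, obtained by
  telescoping \<open>1 - l * \<kappa>' = (1 - l) + l * (1 - \<kappa>')\<close> along the clause: if the summation bits falsify
  \<open>l\<close>, then the factor \<open>b\<close> of \<open>D\<close> at the variable of \<open>l\<close> equals \<open>l\<close>, and \<open>b * (1 - b) = -(x\<^sub>v\<^sup>2 - x\<^sub>v)\<close>.\<close>

fun bool_coeff :: "nat \<Rightarrow> nat \<Rightarrow> clause \<Rightarrow> nat formula" where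
  "bool_coeff N v [] = FZero"
| "bool_coeff N v (l # \<kappa>) =
     FPlus (if fst l = v then FTimes FNegOne (point_formula N (removeAll v [0..<N])) else FZero)
       (FTimes (lit_formula N l) (bool_coeff N v \<kappa>))"

text \<open>A clause axiom gets the point polynomial where it is the first falsified clause; a
  Boolean axiom collects its corrections over all clauses. \<open>cnf_axioms\<close> lists the
  clauses first, hence the shift \<open>j - m\<close>.\<close>

definition axiom_coeff :: "cnf \<Rightarrow> nat \<Rightarrow> nat formula" where
  "axiom_coeff \<tau> j = (let N = num_vars \<tau>; m = length \<tau> in
     if j < m then FTimes (first_formula \<tau> j) (point_formula N [0..<N])
     else fsum (map (\<lambda>i. FTimes (first_formula \<tau> i)
       (bool_coeff N (sorted_list_of_set (cnf_vars \<tau>) ! (j - m)) (\<tau> ! i))) [0..<m]))"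

definition cert_formula :: "cnf \<Rightarrow> nat formula" where
  "cert_formula \<tau> = fsum (map (\<lambda>j. FTimes (FVar (2 * num_vars \<tau> + j)) (axiom_coeff \<tau> j))
     [0..<length \<tau> + card (cnf_vars \<tau>)])"

lemma feval_lit_formula [simp]: "feval \<sigma> (lit_formula a l) = lit_poly (\<lambda>v. \<sigma> (a + v)) l"
  by (cases "(a, l)" rule: lit_formula.cases) auto

lemma feval_clause_formula [simp]:
  "feval \<sigma> (clause_formula a \<kappa>) = clause_poly (\<lambda>v. \<sigma> (a + v)) \<kappa>"
  by (simp add: clause_formula_def clause_poly_def feval_fprod o_def)

lemma fvars_lit_formula [simp]: "fvars (lit_formula a l) = {a + fst l}"
  by (cases "(a, l)" rule: lit_formula.cases) auto

section \<open>Size of the certificate formula\<close>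

lemma fsize_lit_formula: "fsize (lit_formula a l) \<le> 5"
  by (cases "(a, l)" rule: lit_formula.cases) auto

lemma fsize_clause_formula:
  assumes "length \<kappa> \<le> s"
  shows "fsize (clause_formula a \<kappa>) \<le> 6 * s + 1"
proof -
  have "fsize (clause_formula a \<kappa>) \<le> s * (5 + 1) + 1"
    unfolding clause_formula_def using assms fsize_lit_formula by (intro fsize_fprod) auto
  then show ?thesis by simp
qed

lemma fsize_point_formula:
  assumes "length vs \<le> s"
  shows "fsize (point_formula N vs) \<le> 16 * s + 1"
proof -
  \<comment> \<open>A \<open>select_formula\<close> has size 15, and \<open>fprod\<close> adds one
    node per factor.\<close>
  have "fsize (point_formula N vs) \<le> s * (15 + 1) + 1"
    unfolding point_formula_def using assms by (intro fsize_fprod) (auto simp: select_formula_def)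
  then show ?thesis by simp
qed

lemma fsize_first_formula:
  assumes "i < length \<tau>" "cnf_size \<tau> \<le> s"
  shows "fsize (first_formula \<tau> i) \<le> 6 * s + s * (6 * s + 6) + 3"
proof -
  have len: "length \<kappa> \<le> s" if "\<kappa> \<in> set \<tau>" for \<kappa>
    using cnf_size_bounds(3)[OF that] assms(2) by linarith
  have "fsize (fprod (map (\<lambda>\<kappa>. fnot (clause_formula 0 \<kappa>)) (take i \<tau>))) \<le> s * (6 * s + 5 + 1) + 1"
  proof (rule fsize_fprod)
    fix \<phi> assume "\<phi> \<in> set (map (\<lambda>\<kappa>. fnot (clause_formula 0 \<kappa>)) (take i \<tau>))"
    then obtain \<kappa> where "\<kappa> \<in> set \<tau>" "\<phi> = fnot (clause_formula 0 \<kappa>)"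
      by (auto dest: in_set_takeD)
    then show "fsize \<phi> \<le> 6 * s + 5" using fsize_clause_formula[OF len, of \<kappa> 0] by simp
  qed (use cnf_size_bounds(2)[of \<tau>] assms(2) in auto)
  moreover have "fsize (clause_formula 0 (\<tau> ! i)) \<le> 6 * s + 1"
    using assms(1) by (intro fsize_clause_formula len) simp
  ultimately show ?thesis by (simp add: first_formula_def algebra_simps)
qed

text \<open>Each literal costs \<open>16 * N + 3\<close> for the negated point product, 5 for its
  own formula and 2 for the connecting nodes.\<close>

lemma fsize_bool_coeff: "fsize (bool_coeff N v \<kappa>) \<le> length \<kappa> * (16 * N + 10) + 1"
proof (induction \<kappa>)
  case (Cons l \<kappa>)
  have "length (removeAll v [0..<N]) \<le> N"
    by (metis length_removeAll_less_eq length_upt minus_nat.diff_0)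
  then have "fsize (point_formula N (removeAll v [0..<N])) \<le> 16 * N + 1"
    by (rule fsize_point_formula)
  with Cons fsize_lit_formula[of N l] show ?case by auto
qed simp

text \<open>\<open>F\<close>, \<open>C\<close> and \<open>A\<close> bound the sizes of
  \<open>first_formula\<close>, \<open>bool_coeff\<close> and \<open>axiom_coeff\<close>; there are
  at most \<open>2 * s\<close> axioms, each adding 3 nodes to its coefficient.\<close>

definition cert_bound :: "nat \<Rightarrow> nat" where
  "cert_bound s = (let F = 6 * s + s * (6 * s + 6) + 3; C = s * (16 * s + 10) + 1;
     A = s * (F + C + 2) + F + 16 * s + 3 in 2 * s * (A + 3) + 1)"

text \<open>The bound adds those of the two cases: \<open>F + 16 * s + 2\<close> for a clause axiom
  and \<open>s * (F + C + 2) + 1\<close> for a Boolean axiom.\<close>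

lemma fsize_axiom_coeff:
  assumes "j < length \<tau> + card (cnf_vars \<tau>)" and s: "cnf_size \<tau> \<le> s"
  defines "F \<equiv> 6 * s + s * (6 * s + 6) + 3" and "C \<equiv> s * (16 * s + 10) + 1"
  shows "fsize (axiom_coeff \<tau> j) \<le> s * (F + C + 2) + F + 16 * s + 3"
proof -
  let ?N = "num_vars \<tau>"
  have bounds: "?N \<le> s" "length \<tau> \<le> s" "\<kappa> \<in> set \<tau> \<Longrightarrow> length \<kappa> \<le> s" for \<kappa>
    using cnf_size_bounds(1,2)[of \<tau>] cnf_size_bounds(3)[of \<kappa> \<tau>] s by linarith+
  have first: "fsize (first_formula \<tau> i) \<le> F" if "i < length \<tau>" for i
    unfolding F_def by (rule fsize_first_formula[OF that s])
  show ?thesis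
  proof (cases "j < length \<tau>")
    case True
    with first[OF True] fsize_point_formula[of "[0..<?N]" s ?N] bounds(1) show ?thesis
      by (simp add: axiom_coeff_def Let_def)
  next
    case False
    let ?v = "sorted_list_of_set (cnf_vars \<tau>) ! (j - length \<tau>)"
    have coeff: "fsize (bool_coeff ?N ?v (\<tau> ! i)) \<le> C" if "i < length \<tau>" for i
    proof -
      have "length (\<tau> ! i) * (16 * ?N + 10) \<le> s * (16 * s + 10)"
        using bounds that by (intro mult_le_mono) auto
      with fsize_bool_coeff[of ?N ?v "\<tau> ! i"] show ?thesis by (simp add: C_def)
    qed
    have "fsize (fsum (map (\<lambda>i. FTimes (first_formula \<tau> i) (bool_coeff ?N ?v (\<tau> ! i)))
        [0..<length \<tau>])) \<le> s * ((F + C + 1) + 1) + 1"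
    proof (rule fsize_fsum)
      fix \<phi> assume "\<phi> \<in> set (map (\<lambda>i. FTimes (first_formula \<tau> i) (bool_coeff ?N ?v (\<tau> ! i)))
        [0..<length \<tau>])"
      then obtain i where "i < length \<tau>" "\<phi> = FTimes (first_formula \<tau> i) (bool_coeff ?N ?v (\<tau> ! i))"
        by auto
      with first[of i] coeff[of i] show "fsize \<phi> \<le> F + C + 1" by simp
    qed (use bounds(2) in simp)
    with False have "fsize (axiom_coeff \<tau> j) \<le> s * ((F + C + 1) + 1) + 1"
      by (simp add: axiom_coeff_def Let_def)
    then show ?thesis by simp
  qed
qed

lemma fsize_cert_formula:
  assumes "cnf_size \<tau> \<le> s"
  shows "fsize (cert_formula \<tau>) \<le> cert_bound s"
proof -
  define F C where "F = 6 * s + s * (6 * s + 6) + 3" and "C = s * (16 * s + 10) + 1"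
  define A where "A = s * (F + C + 2) + F + 16 * s + 3"
  have "fsize (axiom_coeff \<tau> j) \<le> A" if "j < length \<tau> + card (cnf_vars \<tau>)" for j
    unfolding A_def F_def C_def by (rule fsize_axiom_coeff[OF that assms])
  \<comment> \<open>The number of axioms does not depend on the ring; the integers serve as an
    arbitrary instance.\<close>
  moreover have "length \<tau> + card (cnf_vars \<tau>) \<le> 2 * s"
    using cnf_size_bounds(4)[of "\<lambda>_. 0::int" \<tau>] assms by (simp add: length_cnf_axioms)
  ultimately have "fsize (cert_formula \<tau>) \<le> 2 * s * ((A + 2) + 1) + 1"
    unfolding cert_formula_def by (intro fsize_fsum) auto
  moreover have "cert_bound s = 2 * s * (A + 3) + 1"
    by (simp only: cert_bound_def A_def F_def C_def Let_def)
  ultimately show ?thesis by (simp add: algebra_simps)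
qed

lemma poly_bounded_cert_bound:
  assumes "poly_bounded s"
  shows "poly_bounded (\<lambda>n. cert_bound (s n))"
  unfolding cert_bound_def Let_def
  by (intro poly_bounded_add poly_bounded_mult poly_bounded_const assms)

section \<open>Variables of the certificate formula\<close>

lemma cnf_vars_nth:
  assumes "i < length \<tau>" "l \<in> set (\<tau> ! i)"
  shows "fst l < num_vars \<tau>"
proof -
  have "\<tau> ! i \<in> set \<tau>" using assms(1) by simp
  with assms(2) have "fst l \<in> cnf_vars \<tau>" unfolding cnf_vars_def by blast
  then show ?thesis using cnf_vars_subset by blast
qed

lemma fvars_point_formula: "set vs \<subseteq> {..<N} \<Longrightarrow> fvars (point_formula N vs) \<subseteq> {..<2 * N}"
  by (auto simp: point_formula_def select_formula_def)

lemma fvars_bool_coeff: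
  assumes "\<forall>l\<in>set \<kappa>. fst l < N"
  shows "fvars (bool_coeff N v \<kappa>) \<subseteq> {..<2 * N}"
  using assms
proof (induction \<kappa>)
  case (Cons l \<kappa>)
  have "fvars (point_formula N (removeAll v [0..<N])) \<subseteq> {..<2 * N}"
    by (rule fvars_point_formula) auto
  with Cons show ?case by (auto split: if_splits)
qed simp

lemma fvars_first_formula:
  assumes "i < length \<tau>"
  shows "fvars (first_formula \<tau> i) \<subseteq> {..<2 * num_vars \<tau>}"
proof -
  have "fvars (clause_formula 0 \<kappa>) \<subseteq> {..<num_vars \<tau>}" if "\<kappa> \<in> set \<tau>" for \<kappa>
    using that cnf_vars_nth[of _ \<tau>] by (force simp: clause_formula_def in_set_conv_nth)
  then have "fvars (clause_formula 0 \<kappa>) \<subseteq> {..<2 * num_vars \<tau>}" if "\<kappa> \<in> set \<tau>" for \<kappa>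
    using that by fastforce
  moreover have "\<tau> ! i \<in> set \<tau>" "set (take i \<tau>) \<subseteq> set \<tau>"
    using assms by (simp_all add: set_take_subset)
  ultimately show ?thesis
    unfolding first_formula_def by auto
qed

text \<open>Below \<open>2 * num_vars \<tau>\<close> there are only bits and original variables: the
  coefficients are free of placeholders, as a Hilbert-like certificate requires.\<close>

lemma fvars_axiom_coeff: "fvars (axiom_coeff \<tau> j) \<subseteq> {..<2 * num_vars \<tau>}"
proof (cases "j < length \<tau>")
  case True
  moreover have "fvars (point_formula (num_vars \<tau>) [0..<num_vars \<tau>]) \<subseteq> {..<2 * num_vars \<tau>}"
    by (rule fvars_point_formula) auto
  ultimately show ?thesis
    using fvars_first_formula[of j \<tau>] by (simp add: axiom_coeff_def Let_def)
next
  case False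
  have "fvars (bool_coeff (num_vars \<tau>) v (\<tau> ! i)) \<subseteq> {..<2 * num_vars \<tau>}" if "i < length \<tau>" for i v
    using cnf_vars_nth[OF that] by (intro fvars_bool_coeff) auto
  with False fvars_first_formula[of _ \<tau>] show ?thesis
    by (fastforce simp: axiom_coeff_def Let_def)
qed

lemma fvars_cert_formula:
  "fvars (cert_formula \<tau>) \<subseteq> {..<2 * num_vars \<tau> + (length \<tau> + card (cnf_vars \<tau>))}"
  using fvars_axiom_coeff[of \<tau>] by (fastforce simp: cert_formula_def)

section \<open>The certificate identity\<close>

text \<open>The substitution of \<open>inVNP\<close> in any ring, with free values for the remaining
  variables: \<open>\<xi> v\<close> with \<open>v < N\<close> stands for \<open>x_v\<close> and
  \<open>\<xi> (N + j)\<close> for \<open>y_j\<close>. Identities proved once then serve both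
  variable types.\<close>

definition vnp_assign :: "nat \<Rightarrow> nat set \<Rightarrow> (nat \<Rightarrow> 'r::comm_ring_1) \<Rightarrow> nat \<Rightarrow> 'r" where
  "vnp_assign N S \<xi> i = (if i < N then (if i \<in> S then 1 else 0) else \<xi> (i - N))"

lemma lit_poly_bits:
  "lit_poly (\<lambda>v. if v \<in> S then 1 else 0) l = (if (fst l \<in> S) = snd l then 0 else 1)"
  by (cases l; cases "snd l") auto

lemma clause_poly_bits:
  "clause_poly (\<lambda>v. if v \<in> S then 1 else 0) \<kappa> = (if \<exists>l\<in>set \<kappa>. (fst l \<in> S) = snd l then 0 else 1)"
  by (induction \<kappa>) (auto simp: clause_poly_def lit_poly_bits)

lemma clause_poly_cong:
  assumes "\<forall>l\<in>set \<kappa>. \<iota> (fst l) = \<iota>' (fst l)"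
  shows "clause_poly \<iota> \<kappa> = clause_poly \<iota>' \<kappa>"
proof -
  have "lit_poly \<iota> l = lit_poly \<iota>' l" if "\<iota> (fst l) = \<iota>' (fst l)" for l
    using that by (cases l; cases "snd l") auto
  with assms show ?thesis
    unfolding clause_poly_def by (intro arg_cong[where f = prod_list] map_cong) auto
qed

definition point_factor :: "nat set \<Rightarrow> (nat \<Rightarrow> 'r::comm_ring_1) \<Rightarrow> nat \<Rightarrow> 'r" where
  "point_factor S \<xi> v = (if v \<in> S then \<xi> v else 1 - \<xi> v)"

lemma feval_point_formula:
  assumes "set vs \<subseteq> {..<N}" "distinct vs"
  shows "feval (vnp_assign N S \<xi>) (point_formula N vs) = (\<Prod>v\<in>set vs. point_factor S \<xi> v)"
proof -
  have "feval (vnp_assign N S \<xi>) (select_formula N v) = point_factor S \<xi> v" if "v < N" for v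
    using that by (simp add: select_formula_def vnp_assign_def point_factor_def)
  then have "map (feval (vnp_assign N S \<xi>)) (map (select_formula N) vs) = map (point_factor S \<xi>) vs"
    using assms(1) by auto
  then show ?thesis
    unfolding point_formula_def feval_fprod
    using assms(2) by (simp only: prod.distinct_set_conv_list)
qed

text \<open>Expand the product of all \<open>\<xi> v + (1 - \<xi> v) = 1\<close> by the set
  \<open>S\<close> of factors that contribute \<open>\<xi> v\<close>.\<close>

lemma sum_prod_point_factor:
  assumes "finite A"
  shows "(\<Sum>S\<in>Pow A. \<Prod>v\<in>A. point_factor S \<xi> v) = 1"
proof -
  have "(\<Prod>v\<in>A. point_factor S \<xi> v) = (\<Prod>v\<in>S. \<xi> v) * (\<Prod>v\<in>A - S. 1 - \<xi> v)" if "S \<in> Pow A" for S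
  proof -
    have "(\<Prod>v\<in>A. point_factor S \<xi> v) = (\<Prod>v\<in>A - S. point_factor S \<xi> v) * (\<Prod>v\<in>S. point_factor S \<xi> v)"
      using that assms by (intro prod.subset_diff) auto
    then show ?thesis by (simp add: point_factor_def mult.commute)
  qed
  then have "(\<Sum>S\<in>Pow A. \<Prod>v\<in>A. point_factor S \<xi> v) =
      (\<Sum>S\<in>Pow A. (\<Prod>v\<in>S. \<xi> v) * (\<Prod>v\<in>A - S. 1 - \<xi> v))"
    by (rule sum.cong[OF refl])
  also have "\<dots> = (\<Prod>v\<in>A. \<xi> v + (1 - \<xi> v))"
    by (rule prod_add[OF assms, symmetric])
  finally show ?thesis by simp
qed

text \<open>Since \<open>S\<close> falsifies every literal, each literal polynomial equals the point
  factor of its variable, which drives the telescoping. Contributions of a repeated variable add up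
  in one coefficient.\<close>

lemma bool_coeff_identity:
  assumes "\<forall>l\<in>set \<kappa>. fst l \<in> V \<and> (fst l \<in> S) \<noteq> snd l" "finite V" "V \<subseteq> {..<N}"
  shows "(\<Sum>v\<in>V. (\<xi> v ^ 2 - \<xi> v) * feval (vnp_assign N S \<xi>) (bool_coeff N v \<kappa>)) =
    (\<Prod>v<N. point_factor S \<xi> v) * (1 - clause_poly \<xi> \<kappa>)"
  using assms(1)
proof (induction \<kappa>)
  case Nil
  then show ?case by (simp add: clause_poly_def)
next
  case (Cons l \<kappa>)
  let ?D = "\<Prod>v<N. point_factor S \<xi> v"
  obtain u b where l: "l = (u, b)" by fastforce
  have u: "u \<in> V" "u < N" "(u \<in> S) \<noteq> b" using Cons.prems assms(3) by (auto simp: l)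
  have lit: "lit_poly \<xi> l = point_factor S \<xi> u"
    using u by (cases b) (auto simp: l point_factor_def)
  have litf: "feval (vnp_assign N S \<xi>) (lit_formula N l) = point_factor S \<xi> u"
    by (simp add: vnp_assign_def lit)
  have fst_l: "fst l = u" by (simp add: l)
  have "set (removeAll u [0..<N]) = {..<N} - {u}" by auto
  then have P: "feval (vnp_assign N S \<xi>) (point_formula N (removeAll u [0..<N])) =
      (\<Prod>v\<in>{..<N} - {u}. point_factor S \<xi> v)"
    by (subst feval_point_formula) (auto simp: distinct_removeAll)
  have D: "?D = point_factor S \<xi> u * (\<Prod>v\<in>{..<N} - {u}. point_factor S \<xi> v)"
    using u(2) by (subst prod.remove[of _ u]) auto
  have sq: "point_factor S \<xi> u * (1 - point_factor S \<xi> u) = - (\<xi> u ^ 2 - \<xi> u)"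
    by (simp add: point_factor_def power2_eq_square algebra_simps)
  \<comment> \<open>The head literal adds to the coefficient of its own variable \<open>u\<close>
    alone; all coefficients of the tail are multiplied by its point factor.\<close>
  have "(\<Sum>v\<in>V. (\<xi> v ^ 2 - \<xi> v) * feval (vnp_assign N S \<xi>) (bool_coeff N v (l # \<kappa>))) =
      (\<Sum>v\<in>V. if v = u then - (\<xi> v ^ 2 - \<xi> v) *
          feval (vnp_assign N S \<xi>) (point_formula N (removeAll v [0..<N])) else 0) +
      (\<Sum>v\<in>V. point_factor S \<xi> u *
          ((\<xi> v ^ 2 - \<xi> v) * feval (vnp_assign N S \<xi>) (bool_coeff N v \<kappa>)))"
    unfolding sum.distrib[symmetric]
    by (intro sum.cong refl) (auto simp: litf fst_l algebra_simps simp del: feval_lit_formula)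
  also have "\<dots> = - (\<xi> u ^ 2 - \<xi> u) * (\<Prod>v\<in>{..<N} - {u}. point_factor S \<xi> v) +
      point_factor S \<xi> u * (?D * (1 - clause_poly \<xi> \<kappa>))"
    using u(1) assms(2) Cons by (simp add: P sum.delta flip: sum_distrib_left)
  \<comment> \<open>By \<open>sq\<close> the Boolean axiom of \<open>u\<close> supplies the point
    factor missing from the product over \<open>{..<N} - {u}\<close>.\<close>
  also have "\<dots> = ?D * (1 - point_factor S \<xi> u) + point_factor S \<xi> u * (?D * (1 - clause_poly \<xi> \<kappa>))"
    unfolding sq[symmetric] D by (simp add: mult_ac)
  also have "\<dots> = ?D * (1 - clause_poly \<xi> (l # \<kappa>))"
    by (simp add: clause_poly_def lit algebra_simps)
  finally show ?case .
qed

text \<open>Each summand is the difference of two consecutive partial products of the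
  \<open>1 - a j\<close>.\<close>

lemma sum_first_indicator:
  fixes a :: "nat \<Rightarrow> 'r::comm_ring_1"
  shows "(\<Sum>i<m. a i * (\<Prod>j<i. 1 - a j)) = 1 - (\<Prod>i<m. 1 - a i)"
  by (induction m) (auto simp: algebra_simps)

text \<open>All literals lie below \<open>N\<close>, so at offset 0 they meet only bits and the
  value does not depend on \<open>\<xi>\<close>.\<close>

lemma feval_first_formula:
  fixes \<xi> :: "nat \<Rightarrow> 'r::comm_ring_1" and S :: "nat set"
  assumes "i < length \<tau>" "N = num_vars \<tau>"
  defines "k \<equiv> \<lambda>i. clause_poly (\<lambda>v. if v \<in> S then 1 else 0) (\<tau> ! i)"
  shows "feval (vnp_assign N S \<xi>) (first_formula \<tau> i) = k i * (\<Prod>j<i. 1 - k j)"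
proof -
  have *: "feval (vnp_assign N S \<xi>) (clause_formula 0 (\<tau> ! j)) = k j" if "j < length \<tau>" for j
    unfolding feval_clause_formula k_def using cnf_vars_nth[OF that] assms(2)
    by (intro clause_poly_cong) (auto simp: vnp_assign_def)
  have "take i \<tau> = map ((!) \<tau>) [0..<i]"
    using assms(1) by (intro nth_equalityI) auto
  then have "map (feval (vnp_assign N S \<xi>)) (map (\<lambda>\<kappa>. fnot (clause_formula 0 \<kappa>)) (take i \<tau>)) =
      map (\<lambda>j. 1 - k j) [0..<i]"
    using assms(1) * by auto
  then have "feval (vnp_assign N S \<xi>) (fprod (map (\<lambda>\<kappa>. fnot (clause_formula 0 \<kappa>)) (take i \<tau>))) =
      (\<Prod>j<i. 1 - k j)"
    unfolding feval_fprod
    by (simp only: prod.distinct_set_conv_list[of "[0..<i]", symmetric] distinct_upt)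
       (simp add: lessThan_atLeast0)
  with *[OF assms(1)] show ?thesis by (simp add: first_formula_def)
qed

definition cert_coeff :: "cnf \<Rightarrow> nat \<Rightarrow> (nat \<Rightarrow> 'r::comm_ring_1) \<Rightarrow> 'r" where
  "cert_coeff \<tau> j \<xi> = (\<Sum>S\<in>Pow {..<num_vars \<tau>}. feval (vnp_assign (num_vars \<tau>) S \<xi>) (axiom_coeff \<tau> j))"

lemma sum_cert_formula:
  "(\<Sum>S\<in>Pow {..<num_vars \<tau>}. feval (vnp_assign (num_vars \<tau>) S \<xi>) (cert_formula \<tau>)) =
   (\<Sum>j<length \<tau> + card (cnf_vars \<tau>). \<xi> (num_vars \<tau> + j) * cert_coeff \<tau> j \<xi>)"
proof -
  let ?N = "num_vars \<tau>" and ?M = "length \<tau> + card (cnf_vars \<tau>)"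
  have y: "vnp_assign ?N S \<xi> (2 * ?N + j) = \<xi> (?N + j)" for S j
    by (simp add: vnp_assign_def)
  have "feval (vnp_assign ?N S \<xi>) (cert_formula \<tau>) =
      (\<Sum>j<?M. \<xi> (?N + j) * feval (vnp_assign ?N S \<xi>) (axiom_coeff \<tau> j))" for S
    unfolding cert_formula_def feval_fsum
    by (simp add: o_def y sum_list_distinct_conv_sum_set lessThan_atLeast0)
  then show ?thesis
    unfolding cert_coeff_def sum_distrib_left by (subst sum.swap) simp
qed

lemma sum_lessThan_add:
  fixes f :: "nat \<Rightarrow> 'r::comm_monoid_add"
  shows "(\<Sum>j<m + n. f j) = (\<Sum>j<m. f j) + (\<Sum>t<n. f (m + t))"
  by (induction n) (simp_all add: add.assoc)

text \<open>After exchanging the sums it suffices that for each point \<open>S\<close> the axioms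
  combine to \<open>D S\<close>, since these sum to 1.\<close>

lemma cert_coeff_identity:
  assumes "unsat_cnf \<tau>"
  shows "(\<Sum>j<length \<tau> + card (cnf_vars \<tau>). cnf_axioms \<xi> \<tau> ! j * cert_coeff \<tau> j \<xi>) = 1"
proof -
  define N m V where "N = num_vars \<tau>" and "m = length \<tau>" and "V = cnf_vars \<tau>"
  define vs where "vs = sorted_list_of_set V"
  have V: "finite V" "V \<subseteq> {..<N}" by (simp_all add: V_def N_def cnf_vars_subset)
  have vs: "distinct vs" "set vs = V" "length vs = card V" using V by (simp_all add: vs_def)
  define D where "D S = (\<Prod>v<N. point_factor S \<xi> v)" for S
  define k where "k S i = (clause_poly (\<lambda>v. if v \<in> S then 1 else 0) (\<tau> ! i) :: 'a)" for S i
  define first where "first S i = k S i * (\<Prod>j<i. 1 - k S j)" for S i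
  have first: "feval (vnp_assign N S \<xi>) (first_formula \<tau> i) = first S i" if "i < m" for S i
    unfolding first_def k_def using that by (intro feval_first_formula) (simp_all add: m_def N_def)
  have "(\<Sum>j<m + card V. cnf_axioms \<xi> \<tau> ! j * feval (vnp_assign N S \<xi>) (axiom_coeff \<tau> j)) = D S" for S
  proof -
    let ?f = "\<lambda>j. cnf_axioms \<xi> \<tau> ! j * feval (vnp_assign N S \<xi>) (axiom_coeff \<tau> j)"
    have clause: "?f i = clause_poly \<xi> (\<tau> ! i) * (first S i * D S)" if "i < m" for i
    proof -
      have "feval (vnp_assign N S \<xi>) (point_formula N [0..<N]) = D S"
        by (subst feval_point_formula) (auto simp: D_def lessThan_atLeast0)
      then show ?thesis
        using that first[OF that]
        by (simp add: cnf_axioms_def axiom_coeff_def Let_def m_def N_def nth_append)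
    qed
    have bool: "?f (m + t) = (\<Sum>i<m. first S i *
        ((\<xi> (vs ! t) ^ 2 - \<xi> (vs ! t)) * feval (vnp_assign N S \<xi>) (bool_coeff N (vs ! t) (\<tau> ! i))))"
      if "t < card V" for t
    proof -
      have "feval (vnp_assign N S \<xi>) (axiom_coeff \<tau> (m + t)) =
          (\<Sum>i<m. first S i * feval (vnp_assign N S \<xi>) (bool_coeff N (vs ! t) (\<tau> ! i)))"
        by (simp add: axiom_coeff_def Let_def feval_fsum o_def sum_list_distinct_conv_sum_set
            first lessThan_atLeast0 flip: m_def N_def V_def vs_def)
      moreover have "cnf_axioms \<xi> \<tau> ! (m + t) = \<xi> (vs ! t) ^ 2 - \<xi> (vs ! t)"
        using that vs(3) by (simp add: cnf_axioms_def nth_append m_def flip: V_def vs_def)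
      ultimately show ?thesis by (simp add: sum_distrib_left mult_ac)
    qed
    have tele: "first S i * (\<Sum>v\<in>V. (\<xi> v ^ 2 - \<xi> v) * feval (vnp_assign N S \<xi>) (bool_coeff N v (\<tau> ! i))) =
        first S i * (D S * (1 - clause_poly \<xi> (\<tau> ! i)))" if "i < m" for i
    \<comment> \<open>A nonzero indicator forces all literals of clause \<open>i\<close> to be false
      under \<open>S\<close>, as \<open>bool_coeff_identity\<close> requires; a zero one kills both
      sides.\<close>
    proof (cases "first S i = 0")
      case False
      then have "\<forall>l\<in>set (\<tau> ! i). (fst l \<in> S) \<noteq> snd l"
        by (auto simp: first_def k_def clause_poly_bits split: if_splits)
      moreover have "\<forall>l\<in>set (\<tau> ! i). fst l \<in> V"
        using that nth_mem[of i \<tau>] by (force simp: V_def cnf_vars_def m_def)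
      ultimately show ?thesis
        using bool_coeff_identity[of "\<tau> ! i" V S N \<xi>] V by (simp add: D_def)
    qed simp
    have "(\<Sum>j<m + card V. ?f j) = (\<Sum>i<m. ?f i) + (\<Sum>t<card V. ?f (m + t))"
      by (rule sum_lessThan_add)
    also have "(\<Sum>t<card V. ?f (m + t)) = (\<Sum>i<m. first S i *
        (\<Sum>t<card V. (\<xi> (vs ! t) ^ 2 - \<xi> (vs ! t)) * feval (vnp_assign N S \<xi>) (bool_coeff N (vs ! t) (\<tau> ! i))))"
      unfolding sum_distrib_left by (subst sum.swap) (simp add: bool)
    also have "\<dots> = (\<Sum>i<m. first S i *
        (\<Sum>v\<in>V. (\<xi> v ^ 2 - \<xi> v) * feval (vnp_assign N S \<xi>) (bool_coeff N v (\<tau> ! i))))"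
      using vs by (intro sum.cong refl arg_cong2[where f = "(*)"] sum.reindex_bij_betw
          bij_betw_nth) auto
    also have "\<dots> = (\<Sum>i<m. first S i * (D S * (1 - clause_poly \<xi> (\<tau> ! i))))"
      using tele by simp
    \<comment> \<open>For each clause polynomial \<open>\<kappa>\<close>,
      \<open>\<kappa> * D + D * (1 - \<kappa>) = D\<close> merges the clause part with the Boolean
      part.\<close>
    also have "(\<Sum>i<m. ?f i) + \<dots> = (\<Sum>i<m. first S i) * D S"
      unfolding sum.distrib[symmetric] sum_distrib_right
      by (intro sum.cong refl) (simp add: clause, simp add: algebra_simps)
    \<comment> \<open>Unsatisfiability enters here: some clause is falsified by \<open>S\<close>, so
      the product of the \<open>1 - k S i\<close> has a zero factor.\<close>
    also have "(\<Sum>i<m. first S i) = 1"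
    proof -
      obtain \<kappa> where \<kappa>: "\<kappa> \<in> set \<tau>" "\<not> (\<exists>(v, b)\<in>set \<kappa>. (v \<in> S) = b)"
        using assms unfolding unsat_cnf_def by (elim allE[of _ "\<lambda>v. v \<in> S"]) blast
      from \<kappa>(1) obtain i where i: "i < m" "\<tau> ! i = \<kappa>"
        unfolding m_def in_set_conv_nth by blast
      have "k S i = 1"
        using \<kappa>(2) unfolding k_def clause_poly_bits i(2) by (simp add: case_prod_beta)
      with i(1) have "\<exists>i\<in>{..<m}. 1 - k S i = 0" by (intro bexI[of _ i]) simp_all
      then have "(\<Prod>i<m. 1 - k S i) = 0" by (intro prod_zero finite_lessThan)
      then show ?thesis by (simp add: first_def sum_first_indicator)
    qed
    finally show ?thesis by simp
  qed
  then have "(\<Sum>S\<in>Pow {..<N}. \<Sum>j<m + card V. cnf_axioms \<xi> \<tau> ! j *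
      feval (vnp_assign N S \<xi>) (axiom_coeff \<tau> j)) = (\<Sum>S\<in>Pow {..<N}. D S)"
    by simp
  also have "\<dots> = 1"
    unfolding D_def by (rule sum_prod_point_factor) simp
  finally show ?thesis
    unfolding cert_coeff_def N_def m_def V_def sum_distrib_left by (subst sum.swap)
qed

text \<open>The coefficients contain no placeholders, so values substituted for these cannot change
  them.\<close>

lemma cert_coeff_cong:
  assumes "\<And>v. v < num_vars \<tau> \<Longrightarrow> \<xi> v = \<xi>' v"
  shows "cert_coeff \<tau> j \<xi> = cert_coeff \<tau> j \<xi>'"
  unfolding cert_coeff_def using assms fvars_axiom_coeff[of \<tau> j]
  by (intro sum.cong refl feval_cong) (auto simp: vnp_assign_def)

section \<open>Multiplying a Polynomial Calculus line by a weakly skew circuit\<close>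

text \<open>Derivations that need not end in 1, so that they can be extended piece by piece.\<close>

definition PC_lines :: "(nat, 'a::field) mpoly list \<Rightarrow> (nat, 'a) mpoly list \<Rightarrow> bool" where
  "PC_lines Fs ls \<longleftrightarrow> (\<forall>k<length ls. ls ! k \<in> set Fs \<or>
     (\<exists>i<k. \<exists>j<k. \<exists>\<alpha> \<beta>. ls ! k = PConst \<alpha> * ls ! i + PConst \<beta> * ls ! j) \<or>
     (\<exists>i<k. \<exists>v. ls ! k = PVar v * ls ! i))"

lemma PC_derivation_iff: "PC_derivation Fs ls \<longleftrightarrow> ls \<noteq> [] \<and> last ls = 1 \<and> PC_lines Fs ls"
  by (simp add: PC_derivation_def PC_lines_def)

text \<open>Replaces positions of premises by membership, which spares all index shifts when
  derivations are concatenated.\<close>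

lemma PC_lines_snoc:
  "PC_lines Fs (ls @ [p]) \<longleftrightarrow> PC_lines Fs ls \<and> (p \<in> set Fs \<or>
     (\<exists>q\<in>set ls. \<exists>r\<in>set ls. \<exists>\<alpha> \<beta>. p = PConst \<alpha> * q + PConst \<beta> * r) \<or>
     (\<exists>q\<in>set ls. \<exists>v. p = PVar v * q))"
proof -
  have "(\<forall>k<length (ls @ [p]). P k) \<longleftrightarrow> (\<forall>k<length ls. P k) \<and> P (length ls)" for P
    by (auto simp: less_Suc_eq)
  moreover have "(\<exists>q\<in>set ls. Q q) \<longleftrightarrow> (\<exists>i<length ls. Q (ls ! i))" for Q
    by (metis in_set_conv_nth)
  ultimately show ?thesis
    unfolding PC_lines_def by (simp add: nth_append cong: conj_cong)
qed

lemma PC_lines_lin: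
  assumes "PC_lines Fs ls" "q \<in> set ls" "r \<in> set ls"
  shows "PC_lines Fs (ls @ [PConst \<alpha> * q + PConst \<beta> * r])"
  using assms unfolding PC_lines_snoc by blast

lemma PC_lines_scale:
  assumes "PC_lines Fs ls" "q \<in> set ls"
  shows "PC_lines Fs (ls @ [PConst \<alpha> * q])"
  using PC_lines_lin[OF assms assms(2), of \<alpha> 0] by simp

section \<open>Subcircuits and reusable gates\<close>

lemma in_subcirc_le:
  assumes "args_below gs" "in_subcirc gs i h"
  shows "h \<le> i"
  using assms(2)
proof induction
  case (step j a)
  then show ?case using assms(1) by (fastforce simp: args_below_def)
qed simp

lemma in_subcirc_subset:
  assumes "\<And>h. h \<in> S \<Longrightarrow> h < length gs \<and> gate_args (gs ! h) \<subseteq> S" "i \<in> S" "in_subcirc gs i h"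
  shows "h \<in> S"
  using assms(3) by induction (use assms(1,2) in auto)

text \<open>The gates whose value can be multiplied onto a line once for all of its uses; a gate inside an
  isolated subcircuit only ever gets multiplied onto the other input of that multiplication gate.\<close>

definition reusable :: "('v, 'a) gate list \<Rightarrow> nat set \<Rightarrow> nat set" where
  "reusable gs S = {h \<in> S. \<forall>k\<in>S. \<forall>i j. gs ! k \<in> {Mul i j, Mul j i} \<longrightarrow>
     isolated_input gs k i j \<longrightarrow> \<not> in_subcirc gs i h}"

lemma reusable_mono: "S' \<subseteq> S \<Longrightarrow> h \<in> S' \<Longrightarrow> h \<in> reusable gs S \<Longrightarrow> h \<in> reusable gs S'"
  by (auto simp: reusable_def)

text \<open>The subcircuit at an argument of a gate \<open>h\<close> has only indices below
  \<open>h\<close>, so it misses the largest gate.\<close>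

lemma Max_reusable:
  assumes "args_below gs" "\<And>h. h \<in> S \<Longrightarrow> h \<le> k \<and> h < length gs" "k \<in> S"
  shows "k \<in> reusable gs S"
proof -
  have "\<not> in_subcirc gs i k" if "h \<in> S" "gs ! h \<in> {Mul i j, Mul j i}" for h i j
  proof
    assume "in_subcirc gs i k"
    then have "k \<le> i" by (rule in_subcirc_le[OF assms(1)])
    moreover have "i < h" using assms(1,2) that by (fastforce simp: args_below_def)
    ultimately show False using assms(2)[OF that(1)] by simp
  qed
  then show ?thesis using assms(3) unfolding reusable_def by blast
qed

text \<open>If \<open>a\<close> lay in a subcircuit isolated by some \<open>h\<close> in
  \<open>S'\<close>, then \<open>k\<close>, which differs from \<open>h\<close> and is too large to
  lie in that subcircuit, would reach into it through \<open>a\<close>.\<close>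

lemma arg_reusable:
  assumes "args_below gs" "\<And>h. h \<in> S \<Longrightarrow> h \<le> k \<and> h < length gs" "k \<in> S" "k \<notin> S'" "S' \<subseteq> S"
    and "a \<in> gate_args (gs ! k)" "a \<in> S'"
  shows "a \<in> reusable gs S'"
proof -
  have "\<not> in_subcirc gs i a"
    if "h \<in> S'" "gs ! h \<in> {Mul i j, Mul j i}" "isolated_input gs h i j" for h i j
  proof
    assume a: "in_subcirc gs i a"
    have "k \<noteq> h" using that(1) assms(4) by blast
    moreover have "\<not> in_subcirc gs i k"
      using Max_reusable[OF assms(1-3)] that assms(5) unfolding reusable_def by blast
    ultimately show False
      using that(3) a assms(2)[OF assms(3)] assms(6) unfolding isolated_input_def by blast
  qed
  then show ?thesis using assms(7) unfolding reusable_def by blast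
qed

text \<open>Induction on the size of an argument-closed set \<open>S\<close>, for all lines
  \<open>L\<close>, with the largest gate \<open>k\<close> last. At a product, the rest of
  \<open>S\<close> is multiplied onto \<open>L\<close> and the isolated part onto the resulting
  line; the parts are disjoint, so each gate costs at most one line.\<close>

lemma PC_multiply_weakly_skew:
  fixes gs :: "('v, 'a::field) gate list" and \<sigma> :: "'v \<Rightarrow> (nat, 'a) mpoly"
  assumes gs: "args_below gs" "weakly_skew gs"
    and \<sigma>: "\<And>v. (\<exists>w. \<sigma> v = PVar w) \<or> (\<exists>c. \<sigma> v = PConst c)"
    and S: "finite S" "\<And>h. h \<in> S \<Longrightarrow> h < length gs \<and> gate_args (gs ! h) \<subseteq> S"
    and ls: "PC_lines Fs ls" "L \<in> set ls"
  shows "\<exists>ext. length ext \<le> card S \<and> PC_lines Fs (ls @ ext) \<and>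
    (\<forall>h\<in>reusable gs S. L * circ_vals \<sigma> PConst gs ! h \<in> set (ls @ ext))"
  using S ls
proof (induction "card S" arbitrary: S ls L rule: less_induct)
  case less
  let ?val = "\<lambda>h. circ_vals \<sigma> PConst gs ! h"
  show ?case
  proof (cases "S = {}")
    case True
    with less.prems show ?thesis by (intro exI[of _ "[]"]) (simp add: reusable_def)
  next
    case False
    define k where "k = Max S"
    have k: "k \<in> S" "k < length gs" and le: "\<And>h. h \<in> S \<Longrightarrow> h \<le> k \<and> h < length gs"
      using False less.prems(1,2) by (auto simp: k_def)
    have below: "a < h" if "h \<in> S" "a \<in> gate_args (gs ! h)" for a h
      using gs(1) le[OF that(1)] that(2) by (auto simp: args_below_def)
    have val: "?val k = gate_val \<sigma> PConst (circ_vals \<sigma> PConst gs) (gs ! k)"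
      using gs(1) k(2) by (rule nth_circ_vals)
    show ?thesis
    proof (cases "\<exists>i j. gs ! k = Mul i j")
      case False
      let ?S = "S - {k}"
      have "card ?S < card S" by (rule card_Diff1_less[OF less.prems(1) k(1)])
      moreover have "h < length gs \<and> gate_args (gs ! h) \<subseteq> ?S" if "h \<in> ?S" for h
      proof -
        have "h \<in> S" using that by simp
        then show ?thesis using below[of h k] le[of h] less.prems(2)[of h] by force
      qed
      ultimately obtain ext where ext: "length ext \<le> card ?S" "PC_lines Fs (ls @ ext)"
          "\<forall>h\<in>reusable gs ?S. L * ?val h \<in> set (ls @ ext)"
        using less.hyps[of ?S ls L] less.prems by auto
      have arg: "L * ?val a \<in> set (ls @ ext)" if "a \<in> gate_args (gs ! k)" for a
      proof -
        have "a \<in> ?S" using that below[OF k(1)] less.prems(2)[OF k(1)] by auto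
        then have "a \<in> reusable gs ?S"
          using arg_reusable[OF gs(1) le k(1), of ?S a] that by blast
        then show ?thesis using ext(3) by blast
      qed
      have L: "L \<in> set (ls @ ext)" using less.prems(4) by simp
      \<comment> \<open>One rule suffices for \<open>k\<close>: multiplication by a variable,
        scaling by a constant, or the sum of the lines of its two arguments.\<close>
      have "PC_lines Fs ((ls @ ext) @ [L * ?val k])"
      proof (cases "gs ! k")
        case (Inp v)
        with \<sigma>[of v] show ?thesis
        proof (elim disjE exE)
          fix w assume "\<sigma> v = PVar w"
          with Inp val ext(2) L show ?thesis
            unfolding PC_lines_snoc by (auto simp: mult.commute)
        next
          fix c assume "\<sigma> v = PConst c"
          with Inp val PC_lines_scale[OF ext(2) L, of c] show ?thesis
            by (simp add: mult.commute)
        qed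
      next
        case (Cst c)
        with val PC_lines_scale[OF ext(2) L, of c] show ?thesis by (simp add: mult.commute)
      next
        case (Add i j)
        with val PC_lines_lin[OF ext(2) arg arg, of i j 1 1] show ?thesis
          by (simp add: distrib_left)
      qed (use False in auto)
      moreover have "L * ?val h \<in> set (ls @ ext @ [L * ?val k])" if "h \<in> reusable gs S" for h
      proof (cases "h = k")
        case h: False
        then have "h \<in> ?S" using that by (simp add: reusable_def)
        then have "h \<in> reusable gs ?S" using that by (blast intro: reusable_mono)
        with ext(3) show ?thesis by auto
      qed simp
      moreover have "length (ext @ [L * ?val k]) \<le> card S"
        using ext(1) k(1) less.prems(1) card_Suc_Diff1[of S k] by simp
      ultimately show ?thesis by (intro exI[of _ "ext @ [L * ?val k]"]) simp
    next
      case True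
      \<comment> \<open>By commutativity \<open>j\<close> may always denote the isolated
        argument.\<close>
      then obtain i j where ij: "gs ! k \<in> {Mul i j, Mul j i}" "isolated_input gs k j i"
        using gs(2) k(2) unfolding weakly_skew_def by blast
      have args: "gate_args (gs ! k) = {i, j}" using ij(1) by auto
      have valk: "?val k = ?val i * ?val j" using val ij(1) by (auto simp: mult.commute)
      let ?G = "{h. in_subcirc gs j h}"
      \<comment> \<open>Apart from \<open>k\<close>, no gate outside \<open>?G\<close> refers into
        \<open>?G\<close>, so \<open>?S\<close> is again closed under arguments.\<close>
      let ?S = "S - ?G - {k}"
      have ijS: "i \<in> S" "j \<in> S" "i < k" "j < k"
        using args below[OF k(1)] less.prems(2)[OF k(1)] by auto
      have GS: "?G \<subseteq> S" using in_subcirc_subset[OF less.prems(2) ijS(2)] by blast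
      have Gk: "k \<notin> ?G" using in_subcirc_le[OF gs(1), of j k] ijS(4) by auto
      have finG: "finite ?G" using GS less.prems(1) by (rule finite_subset)
      have iS: "i \<in> ?S" using ijS ij(2) by (auto simp: isolated_input_def)
      have card: "card ?S + card ?G + 1 = card S"
      proof -
        have "S = insert k (?S \<union> ?G)" using GS k(1) by blast
        then have "card S = Suc (card (?S \<union> ?G))"
          using Gk less.prems(1) finG by (metis (no_types, lifting) Diff_iff Un_iff card_insert_disjoint finite_Diff finite_Un insertI1)
        also have "card (?S \<union> ?G) = card ?S + card ?G"
          using less.prems(1) finG by (intro card_Un_disjoint) auto
        finally show ?thesis by simp
      qed
      have "h < length gs \<and> gate_args (gs ! h) \<subseteq> ?S" if "h \<in> ?S" for h
      proof -
        have h: "h \<in> S" "h < length gs" "h \<noteq> k" "\<not> in_subcirc gs j h" using that le by auto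
        have "a \<in> ?S" if "a \<in> gate_args (gs ! h)" for a
        proof -
          have "\<not> in_subcirc gs j a" using ij(2) h that unfolding isolated_input_def by blast
          then show ?thesis using below[OF h(1) that] le[OF h(1)] less.prems(2)[OF h(1)] that by auto
        qed
        with h(2) show ?thesis by blast
      qed
      moreover have "card ?S < card S" using card by linarith
      ultimately obtain ext where ext: "length ext \<le> card ?S" "PC_lines Fs (ls @ ext)"
          "\<forall>h\<in>reusable gs ?S. L * ?val h \<in> set (ls @ ext)"
        using less.hyps[of ?S ls L] less.prems by auto
      have "i \<in> reusable gs ?S"
        using arg_reusable[OF gs(1) le k(1), of ?S i] args iS by blast
      with ext(3) have i: "L * ?val i \<in> set (ls @ ext)" by blast
      have "h < length gs \<and> gate_args (gs ! h) \<subseteq> ?G" if "h \<in> ?G" for h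
        using that GS le in_subcirc.step[of gs j h] by blast
      moreover have "card ?G < card S" using card by linarith
      \<comment> \<open>With \<open>L * ?val i\<close> in the place of \<open>L\<close>, the top
        gate \<open>j\<close> of \<open>?G\<close> already yields the product for \<open>k\<close>,
        without a further line.\<close>
      ultimately obtain ext' where ext': "length ext' \<le> card ?G" "PC_lines Fs ((ls @ ext) @ ext')"
          "\<forall>h\<in>reusable gs ?G. L * ?val i * ?val h \<in> set ((ls @ ext) @ ext')"
        using less.hyps[of ?G "ls @ ext" "L * ?val i"] finG ext(2) i by blast
      have "j \<in> reusable gs ?G"
        using GS le in_subcirc_le[OF gs(1), of j]
        by (intro Max_reusable[OF gs(1)]) (auto intro: in_subcirc.root)
      with ext'(3) have "L * ?val k \<in> set (ls @ ext @ ext')"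
        by (simp add: valk mult.assoc)
      moreover have "L * ?val h \<in> set (ls @ ext @ ext')" if "h \<in> reusable gs S" "h \<noteq> k" for h
      proof -
        \<comment> \<open>Gates in \<open>?G\<close> are not reusable in \<open>S\<close> because
          \<open>k\<close> isolates them; nothing is claimed for them.\<close>
        have "h \<in> ?S" using that k(1) ij unfolding reusable_def by blast
        then have "h \<in> reusable gs ?S" using that by (blast intro: reusable_mono)
        with ext(3) show ?thesis by auto
      qed
      ultimately have "\<forall>h\<in>reusable gs S. L * ?val h \<in> set (ls @ ext @ ext')" by metis
      moreover have "length (ext @ ext') \<le> card S" using ext(1) ext'(1) card by simp
      ultimately show ?thesis using ext'(2) by (intro exI[of _ "ext @ ext'"]) simp
    qed
  qed
qed

text \<open>The output gate has the largest index and is therefore reusable in the set of all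
  gates.\<close>

lemma PC_multiply_circuit:
  fixes gs :: "('v, 'a::field) gate list" and \<sigma> :: "'v \<Rightarrow> (nat, 'a) mpoly"
  assumes "circ_wf gs" "weakly_skew gs"
    and "\<And>v. (\<exists>w. \<sigma> v = PVar w) \<or> (\<exists>c. \<sigma> v = PConst c)"
    and "PC_lines Fs ls" "L \<in> set ls"
  obtains ext where "length ext \<le> length gs" "PC_lines Fs (ls @ ext)"
    "L * msubst \<sigma> (circ_poly gs) \<in> set (ls @ ext)"
proof -
  have gs: "args_below gs" "gs \<noteq> []" using assms(1) by (auto simp: circ_wf_iff)
  let ?k = "length gs - 1"
  have "h < length gs \<and> gate_args (gs ! h) \<subseteq> {..<length gs}" if "h \<in> {..<length gs}" for h
    using that gs(1) by (fastforce simp: args_below_def)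
  then obtain ext where ext: "length ext \<le> length gs" "PC_lines Fs (ls @ ext)"
      "\<forall>h\<in>reusable gs {..<length gs}. L * circ_vals \<sigma> PConst gs ! h \<in> set (ls @ ext)"
    using PC_multiply_weakly_skew[where \<sigma> = \<sigma>, OF gs(1) assms(2,3) finite_lessThan[of "length gs"] _ assms(4,5)]
    by auto
  have "?k \<in> reusable gs {..<length gs}"
    using gs by (intro Max_reusable) auto
  moreover have "msubst \<sigma> (circ_poly gs) = circ_vals \<sigma> PConst gs ! ?k"
    using gs(2) last_conv_nth[of "circ_vals \<sigma> PConst gs"] by (simp add: msubst_circ_poly[OF assms(1)])
  ultimately show ?thesis using ext that by metis
qed

text \<open>Each axiom costs its own line, at most \<open>length gs\<close> lines for the product
  and one for the running sum; two initial lines and a final one make up the 3.\<close>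

lemma PC_derivation_of_certificate:
  fixes gs :: "(nat, 'a::field) gate list" and Fs :: "(nat, 'a) mpoly list"
  assumes gs: "circ_wf gs" "weakly_skew gs" and Fs: "Fs \<noteq> []"
    and \<sigma>: "\<And>j v. (\<exists>w. \<sigma> j v = PVar w) \<or> (\<exists>c. \<sigma> j v = PConst c)"
    and cert: "(\<Sum>j<length Fs. Fs ! j * msubst (\<sigma> j) (circ_poly gs)) = 1"
  obtains ls where "PC_derivation Fs ls" "length ls \<le> length Fs * (length gs + 2) + 3"
proof -
  let ?G = "\<lambda>j. msubst (\<sigma> j) (circ_poly gs)"
  have "\<exists>ls. PC_lines Fs ls \<and> length ls \<le> n * (length gs + 2) + 2 \<and> (\<Sum>j<n. Fs ! j * ?G j) \<in> set ls"
    if "n \<le> length Fs" for n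
    using that
  proof (induction n)
    case 0
    \<comment> \<open>The empty sum 0 is derived as 0 times an axiom, so some axiom must
      exist.\<close>
    have "PC_lines Fs ([] @ [Fs ! 0])" unfolding PC_lines_snoc using Fs by (simp add: PC_lines_def)
    from PC_lines_scale[OF this, of "Fs ! 0" 0] show ?case
      by (intro exI[of _ "[Fs ! 0, 0]"]) simp
  next
    case (Suc n)
    then obtain ls where ls: "PC_lines Fs ls" "length ls \<le> n * (length gs + 2) + 2"
        "(\<Sum>j<n. Fs ! j * ?G j) \<in> set ls" by auto
    have F: "PC_lines Fs (ls @ [Fs ! n])"
      using ls(1) Suc.prems unfolding PC_lines_snoc by simp
    then obtain ext where ext: "length ext \<le> length gs" "PC_lines Fs ((ls @ [Fs ! n]) @ ext)"
        "Fs ! n * ?G n \<in> set ((ls @ [Fs ! n]) @ ext)"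
      by (rule PC_multiply_circuit[where \<sigma> = "\<sigma> n", OF gs \<sigma>, of Fs _ "Fs ! n"]) auto
    then have "PC_lines Fs (((ls @ [Fs ! n]) @ ext) @ [PConst 1 * (\<Sum>j<n. Fs ! j * ?G j) + PConst 1 * (Fs ! n * ?G n)])"
      using ls(3) by (intro PC_lines_lin) auto
    then show ?case
      using ls(2) ext(1)
      by (intro exI[of _ "((ls @ [Fs ! n]) @ ext) @ [\<Sum>j<Suc n. Fs ! j * ?G j]"]) simp
  qed
  from this[of "length Fs"] cert obtain ls where
    ls: "PC_lines Fs ls" "length ls \<le> length Fs * (length gs + 2) + 2" "1 \<in> set ls" by auto
  from PC_lines_scale[OF ls(1,3), of 1] have "PC_lines Fs (ls @ [1])" by simp
  with ls(2) show ?thesis by (intro that[of "ls @ [1]"]) (simp_all add: PC_derivation_iff)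
qed

section \<open>From the certificate to proofs\<close>

lemma msubst_cert_coeff: "msubst \<theta> (cert_coeff \<tau> j \<xi>) = cert_coeff \<tau> j (\<lambda>v. msubst \<theta> (\<xi> v))"
proof -
  have "msubst \<theta> \<circ> vnp_assign N S \<xi> = vnp_assign N S (\<lambda>v. msubst \<theta> (\<xi> v))" for N S
    by (auto simp: vnp_assign_def)
  then show ?thesis by (simp add: cert_coeff_def msubst_sum msubst_feval)
qed

text \<open>With the bits summed away and the indices shifted, variable
  \<open>v < num_vars \<tau>\<close> is \<open>x_v\<close> and \<open>num_vars \<tau> + j\<close> is
  \<open>y_j\<close>.\<close>

definition cert_poly :: "cnf \<Rightarrow> (nat, 'a::comm_ring_1) mpoly" where
  "cert_poly \<tau> =
     (\<Sum>S\<in>Pow {..<num_vars \<tau>}. feval (vnp_assign (num_vars \<tau>) S PVar) (cert_formula \<tau>))"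

lemma msubst_cert_poly_feval: "msubst \<theta> (cert_poly \<tau>) =
    (\<Sum>S\<in>Pow {..<num_vars \<tau>}. feval (vnp_assign (num_vars \<tau>) S \<theta>) (cert_formula \<tau>))"
proof -
  have "msubst \<theta> \<circ> vnp_assign N S PVar = vnp_assign N S \<theta>" for N S
    by (auto simp: vnp_assign_def)
  then show ?thesis by (simp add: cert_poly_def msubst_sum msubst_feval)
qed

lemma msubst_cert_poly: "msubst \<theta> (cert_poly \<tau>) =
    (\<Sum>j<length \<tau> + card (cnf_vars \<tau>). \<theta> (num_vars \<tau> + j) * cert_coeff \<tau> j \<theta>)"
  unfolding msubst_cert_poly_feval by (rule sum_cert_formula)

lemma mpoly_deg_sum_vnp_assign:
  assumes "\<And>v. mpoly_deg (\<theta> v) \<le> 1"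
  shows "mpoly_deg (\<Sum>S\<in>\<S>. feval (vnp_assign N S \<theta>) \<phi>) \<le> fsize \<phi>"
  using assms by (intro mpoly_deg_sum mpoly_deg_feval) (simp add: vnp_assign_def)

lemma inVP_I:
  assumes "poly_bounded h"
    and "\<And>n. mpoly_vars (f n) \<subseteq> {..<h n}" "\<And>n. mpoly_deg (f n) \<le> h n"
    and "\<And>n. \<exists>gs. circ_wf gs \<and> (cf \<longrightarrow> constant_free gs) \<and> length gs \<le> h n \<and> circ_poly gs = f n"
  shows "inVP cf f"
proof -
  obtain c k where h: "\<And>n. h n \<le> c * n ^ k + c" using assms(1) by (auto simp: poly_bounded_def)
  then have "{..<h n} \<subseteq> {..<c * n ^ k + c}" for n by auto
  with h assms(2-4) show ?thesis
    unfolding inVP_def by (intro exI[of _ c] exI[of _ k]) (meson le_trans subset_trans)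
qed

text \<open>The summand is a polynomial-size formula with leaves 0, 1, -1 and variables, hence in VP
  even without constants.\<close>

lemma cert_poly_in_VNP:
  assumes "poly_bounded (\<lambda>n. cnf_size (\<tau> n))"
  shows "(\<lambda>n. cert_poly (\<tau> n)) \<in> VNP_class cf"
proof -
  \<comment> \<open>\<open>cert_bound\<close> covers size and degree; \<open>4 * cnf_size\<close>
    covers bits, variables and placeholders.\<close>
  define h where "h n = cert_bound (cnf_size (\<tau> n)) + 4 * cnf_size (\<tau> n)" for n
  have h: "poly_bounded h"
    unfolding h_def
    by (intro poly_bounded_add poly_bounded_mult poly_bounded_const poly_bounded_cert_bound assms)
  have size: "fsize (cert_formula (\<tau> n)) \<le> h n" for n
    using fsize_cert_formula[OF order_refl, of "\<tau> n"] by (simp add: h_def)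
  have N: "2 * num_vars (\<tau> n) + (length (\<tau> n) + card (cnf_vars (\<tau> n))) \<le> h n" for n
    using cnf_size_bounds(1)[of "\<tau> n"] cnf_size_bounds(4)[of "\<lambda>_. 0::int" "\<tau> n"]
    by (simp add: h_def length_cnf_axioms)
  have vars: "v < h n" if "v \<in> fvars (cert_formula (\<tau> n))" for v n
    using that fvars_cert_formula[of "\<tau> n"] N[of n] by fastforce
  have "inVP cf (\<lambda>n. feval PVar (cert_formula (\<tau> n)) :: (nat, 'a) mpoly)"
  proof (rule inVP_I[OF h])
    fix n
    show "mpoly_vars (feval PVar (cert_formula (\<tau> n)) :: (nat, 'a) mpoly) \<subseteq> {..<h n}"
      using mpoly_vars_feval[of "PVar :: nat \<Rightarrow> (nat, 'a) mpoly" "cert_formula (\<tau> n)"] vars[of _ n]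
      by fastforce
    show "mpoly_deg (feval PVar (cert_formula (\<tau> n)) :: (nat, 'a) mpoly) \<le> h n"
      by (rule le_trans[OF mpoly_deg_feval size]) simp
    show "\<exists>gs :: (nat, 'a) gate list. circ_wf gs \<and> (cf \<longrightarrow> constant_free gs) \<and> length gs \<le> h n \<and>
        circ_poly gs = feval PVar (cert_formula (\<tau> n))"
      using formula_circuit[of "cert_formula (\<tau> n)"] le_trans[OF _ size] by metis
  qed
  moreover have "poly_bounded (\<lambda>n. num_vars (\<tau> n))"
    using assms cnf_size_bounds(1) by (rule poly_bounded_mono)
  moreover have "mpoly_vars (cert_poly (\<tau> n) :: (nat, 'a) mpoly) \<subseteq> {..<h n}" for n
  proof -
    have "mpoly_vars (feval (vnp_assign N S PVar) \<phi> :: (nat, 'a) mpoly) \<subseteq> fvars \<phi> \<union> (\<lambda>v. v - N) ` fvars \<phi>"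
      for N S and \<phi> :: "nat formula"
      using mpoly_vars_feval[of "vnp_assign N S PVar :: nat \<Rightarrow> (nat, 'a) mpoly" \<phi>]
      by (fastforce simp: vnp_assign_def split: if_splits)
    then have "mpoly_vars (cert_poly (\<tau> n) :: (nat, 'a) mpoly) \<subseteq>
        fvars (cert_formula (\<tau> n)) \<union> (\<lambda>v. v - num_vars (\<tau> n)) ` fvars (cert_formula (\<tau> n))"
      unfolding cert_poly_def by (intro order_trans[OF mpoly_vars_sum]) blast
    then show ?thesis using vars[of _ n] by (fastforce intro: le_less_trans[OF diff_le_self])
  qed
  moreover have "mpoly_deg (cert_poly (\<tau> n) :: (nat, 'a) mpoly) \<le> h n" for n
    unfolding cert_poly_def by (rule le_trans[OF mpoly_deg_sum_vnp_assign size]) simp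
  moreover have "cert_poly (\<tau> n) = (\<Sum>S\<in>Pow {..<num_vars (\<tau> n)}.
      msubst (\<lambda>i. if i < num_vars (\<tau> n) then (if i \<in> S then 1 else 0) else PVar (i - num_vars (\<tau> n)))
        (feval PVar (cert_formula (\<tau> n)) :: (nat, 'a) mpoly))" for n
    by (simp add: cert_poly_def msubst_feval vnp_assign_def[abs_def] o_def)
  moreover obtain c k where ck: "\<And>n. h n \<le> c * n ^ k + c" using h by (auto simp: poly_bounded_def)
  ultimately show ?thesis
    unfolding VNP_class_def inVNP_def
    by (intro CollectI exI[of _ "\<lambda>n. feval PVar (cert_formula (\<tau> n))"] exI[of _ "\<lambda>n. num_vars (\<tau> n)"]
        conjI exI[of _ c] exI[of _ k] allI)
       (auto intro: less_le_trans[OF _ ck] le_trans[OF _ ck] subsetD)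
qed

text \<open>Renaming the inputs separates variables from placeholders. The degree is read off the
  formula, since a short circuit may have huge degree.\<close>

lemma hilbert_IPS_proof_of_circuit:
  fixes gs :: "(nat, 'a::comm_ring_1) gate list"
  assumes \<tau>: "unsat_cnf \<tau>" and gs: "circ_wf gs" "cf \<longrightarrow> constant_free gs" "circ_poly gs = cert_poly \<tau>"
  obtains hs :: "(ivar, 'a) gate list"
  where "hilbert_IPS_proof cf \<tau> hs" "length hs = length gs"
    "mpoly_deg (circ_poly hs) \<le> fsize (cert_formula \<tau>)"
proof -
  let ?N = "num_vars \<tau>" and ?M = "length \<tau> + card (cnf_vars \<tau>)"
  define \<rho> where "\<rho> i = (if i < ?N then XV i else YV (i - ?N))" for i
  define X :: "nat \<Rightarrow> (ivar, 'a) mpoly" where "X v = PVar (XV v)" for v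
  define hs where "hs = map (rename_gate \<rho>) gs"
  have C: "circ_poly hs = msubst (PVar \<circ> \<rho>) (cert_poly \<tau>)"
    using gs by (simp add: hs_def circ_poly_rename)
  have coeff: "cert_coeff \<tau> j (PVar \<circ> \<rho>) = cert_coeff \<tau> j X" for j
    by (rule cert_coeff_cong) (simp add: \<rho>_def X_def)
  have C': "circ_poly hs = (\<Sum>j<?M. PVar (YV j) * cert_coeff \<tau> j X)"
    unfolding C msubst_cert_poly coeff by (simp add: \<rho>_def)
  have vars: "mpoly_vars (cert_coeff \<tau> j X) \<subseteq> range XV" for j
  proof -
    have "mpoly_vars (feval (vnp_assign ?N S X) (axiom_coeff \<tau> j)) \<subseteq> range XV" for S
      using mpoly_vars_feval[of "vnp_assign ?N S X" "axiom_coeff \<tau> j"]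
      by (fastforce simp: vnp_assign_def X_def split: if_splits)
    then show ?thesis unfolding cert_coeff_def by (intro order_trans[OF mpoly_vars_sum]) blast
  qed
  \<comment> \<open>Both conditions on a certificate are instances: \<open>\<theta>\<close> is 0 in
    one and lists the axioms in the other.\<close>
  have subst: "msubst (\<lambda>v. case v of XV i \<Rightarrow> PVar (XV i) | YV j \<Rightarrow> \<theta> j) (circ_poly hs) =
      (\<Sum>j<?M. \<theta> j * cert_coeff \<tau> j X)" for \<theta>
    by (simp add: C' msubst_sum msubst_mult msubst_cert_coeff X_def[abs_def])
  have axioms: "cnf_axioms (\<lambda>v. PVar (XV v)) \<tau> = cnf_axioms X \<tau>"
    by (simp add: X_def[abs_def])
  have "mpoly_vars (circ_poly hs) \<subseteq> range XV \<union> YV ` {..<?M}"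
    unfolding C'
  proof (intro order_trans[OF mpoly_vars_sum] UN_least)
    fix j assume "j \<in> {..<?M}"
    then show "mpoly_vars (PVar (YV j) * cert_coeff \<tau> j X) \<subseteq> range XV \<union> YV ` {..<?M}"
      using mpoly_vars_mult[of "PVar (YV j)" "cert_coeff \<tau> j X"] vars[of j] by fastforce
  qed
  moreover have "msubst (\<lambda>v. case v of XV i \<Rightarrow> PVar (XV i) | YV j \<Rightarrow> 0) (circ_poly hs) = 0"
    by (simp add: subst)
  moreover have "msubst (\<lambda>v. case v of XV i \<Rightarrow> PVar (XV i) | YV j \<Rightarrow> cnf_axioms X \<tau> ! j) (circ_poly hs) = 1"
    unfolding subst by (rule cert_coeff_identity[OF \<tau>])
  ultimately have "is_IPS_cert (cnf_axioms (\<lambda>v. PVar (XV v)) \<tau>) (circ_poly hs)"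
    unfolding axioms is_IPS_cert_def length_cnf_axioms by blast
  moreover have "hilbert_like ?M (circ_poly hs)"
    unfolding hilbert_like_def by (intro exI[of _ "\<lambda>j. cert_coeff \<tau> j X"] conjI allI vars C')
  ultimately have "hilbert_IPS_proof cf \<tau> hs"
    using gs unfolding hilbert_IPS_proof_def length_cnf_axioms hs_def
    by (simp add: constant_free_rename)
  moreover have "mpoly_deg (circ_poly hs) \<le> fsize (cert_formula \<tau>)"
    unfolding C msubst_cert_poly_feval by (rule mpoly_deg_sum_vnp_assign) simp
  ultimately show ?thesis using that by (simp add: hs_def)
qed

lemma PC_proof_of_weakly_skew_circuit:
  fixes gs :: "(nat, 'a::field) gate list"
  assumes \<tau>: "unsat_cnf \<tau>" and gs: "circ_wf gs" "weakly_skew gs" "circ_poly gs = cert_poly \<tau>"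
  obtains ls :: "(nat, 'a) mpoly list"
  where "PC_proof \<tau> ls" "length ls \<le> 2 * cnf_size \<tau> * (length gs + 2) + 3"
proof -
  let ?N = "num_vars \<tau>" and ?M = "length \<tau> + card (cnf_vars \<tau>)"
  let ?F = "cnf_axioms PVar \<tau> :: (nat, 'a) mpoly list"
  \<comment> \<open>Setting \<open>y_j\<close> to 1 and the other placeholders to 0 extracts the
    coefficient of axiom \<open>j\<close> from the single circuit \<open>gs\<close>.\<close>
  define \<sigma> :: "nat \<Rightarrow> nat \<Rightarrow> (nat, 'a) mpoly" where
    "\<sigma> j i = (if i < ?N then PVar i else if i = ?N + j then 1 else 0)" for j i
  have "msubst (\<sigma> j) (circ_poly gs) = cert_coeff \<tau> j PVar" if "j < ?M" for j
  proof -
    have "msubst (\<sigma> j) (circ_poly gs) = (\<Sum>i<?M. if i = j then cert_coeff \<tau> i (\<sigma> j) else 0)"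
      unfolding gs(3) msubst_cert_poly by (intro sum.cong) (auto simp: \<sigma>_def)
    also have "\<dots> = cert_coeff \<tau> j (\<sigma> j)" using that by simp
    also have "\<dots> = cert_coeff \<tau> j PVar" by (rule cert_coeff_cong) (simp add: \<sigma>_def)
    finally show ?thesis .
  qed
  then have cert: "(\<Sum>j<length ?F. ?F ! j * msubst (\<sigma> j) (circ_poly gs)) = 1"
    using cert_coeff_identity[OF \<tau>, of "PVar :: nat \<Rightarrow> (nat, 'a) mpoly"] by (simp add: length_cnf_axioms)
  \<comment> \<open>The empty sum is 0, which differs from 1 in a field.\<close>
  then have "?F \<noteq> []" by auto
  moreover have "(\<exists>w. \<sigma> j v = PVar w) \<or> (\<exists>c. \<sigma> j v = PConst c)" for j v
    unfolding \<sigma>_def by (metis PConst_one PConst_zero)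
  ultimately obtain ls where ls: "PC_derivation ?F ls" "length ls \<le> length ?F * (length gs + 2) + 3"
    using PC_derivation_of_certificate[where \<sigma> = \<sigma>, OF gs(1,2) _ _ cert] by metis
  moreover have "length ?F * (length gs + 2) \<le> 2 * cnf_size \<tau> * (length gs + 2)"
    using cnf_size_bounds(4) by (rule mult_le_mono1)
  ultimately show ?thesis
    by (intro that[of ls]) (simp add: PC_proof_def, linarith)
qed

section \<open>Collapses of the classes give polynomial-size proofs\<close>

lemma hilbert_IPS_poly_bounded:
  fixes cf :: bool
  assumes \<tau>: "taut_family \<tau>" and eq: "(VNP_class cf :: (nat \<Rightarrow> (nat, 'a::comm_ring_1) mpoly) set) = VP_class cf"
  shows "\<exists>c k. \<forall>n. \<exists>gs :: (ivar, 'a) gate list. hilbert_IPS_proof cf (\<tau> n) gs \<and>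
    length gs \<le> c * n ^ k + c \<and> mpoly_deg (circ_poly gs) \<le> c * n ^ k + c"
proof -
  have "(\<lambda>n. cert_poly (\<tau> n) :: (nat, 'a) mpoly) \<in> VP_class cf"
    using cert_poly_in_VNP \<tau> eq unfolding taut_family_def by blast
  then obtain c k where ck: "\<And>n. \<exists>gs :: (nat, 'a) gate list. circ_wf gs \<and> (cf \<longrightarrow> constant_free gs) \<and>
      length gs \<le> c * n ^ k + c \<and> circ_poly gs = cert_poly (\<tau> n)"
    by (auto simp: VP_class_def inVP_def)
  \<comment> \<open>One bound has to dominate both the circuit size and the degree of the
    certificate.\<close>
  have "poly_bounded (\<lambda>n. (c * n ^ k + c) + cert_bound (cnf_size (\<tau> n)))"
    using \<tau> unfolding taut_family_def
    by (intro poly_bounded_add poly_bounded_mult poly_bounded_const poly_bounded_power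
        poly_bounded_cert_bound) simp_all
  then obtain d l where dl: "\<And>n. (c * n ^ k + c) + cert_bound (cnf_size (\<tau> n)) \<le> d * n ^ l + d"
    by (auto simp: poly_bounded_def)
  have "\<exists>gs :: (ivar, 'a) gate list. hilbert_IPS_proof cf (\<tau> n) gs \<and>
    length gs \<le> d * n ^ l + d \<and> mpoly_deg (circ_poly gs) \<le> d * n ^ l + d" for n
  proof -
    obtain gs :: "(nat, 'a) gate list" where gs: "circ_wf gs" "cf \<longrightarrow> constant_free gs"
        "length gs \<le> c * n ^ k + c" "circ_poly gs = cert_poly (\<tau> n)" using ck[of n] by blast
    have "unsat_cnf (\<tau> n)" using \<tau> by (simp add: taut_family_def)
    then obtain hs :: "(ivar, 'a) gate list" where "hilbert_IPS_proof cf (\<tau> n) hs" "length hs = length gs"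
        "mpoly_deg (circ_poly hs) \<le> fsize (cert_formula (\<tau> n))"
      by (rule hilbert_IPS_proof_of_circuit[OF _ gs(1,2,4)])
    then show ?thesis
      using gs(3) dl[of n] fsize_cert_formula[OF order_refl, of "\<tau> n"]
      by (intro exI[of _ hs]) linarith
  qed
  then show ?thesis by blast
qed

lemma PC_poly_bounded:
  assumes \<tau>: "taut_family \<tau>" and eq: "(VNP_class False :: (nat \<Rightarrow> (nat, 'a::field) mpoly) set) = VPws_class"
  shows "\<exists>c k. \<forall>n. \<exists>ls :: (nat, 'a) mpoly list. PC_proof (\<tau> n) ls \<and> length ls \<le> c * n ^ k + c"
proof -
  have "(\<lambda>n. cert_poly (\<tau> n) :: (nat, 'a) mpoly) \<in> VPws_class"
    using cert_poly_in_VNP \<tau> eq unfolding taut_family_def by blast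
  then obtain c k where ck: "\<And>n. \<exists>gs :: (nat, 'a) gate list. circ_wf gs \<and> weakly_skew gs \<and>
      length gs \<le> c * n ^ k + c \<and> circ_poly gs = cert_poly (\<tau> n)"
    by (auto simp: VPws_class_def inVPws_def)
  have "poly_bounded (\<lambda>n. 2 * cnf_size (\<tau> n) * ((c * n ^ k + c) + 2) + 3)"
    using \<tau> unfolding taut_family_def
    by (intro poly_bounded_add poly_bounded_mult poly_bounded_const poly_bounded_power) simp_all
  then obtain d l where dl: "\<And>n. 2 * cnf_size (\<tau> n) * ((c * n ^ k + c) + 2) + 3 \<le> d * n ^ l + d"
    by (auto simp: poly_bounded_def)
  have "\<exists>ls :: (nat, 'a) mpoly list. PC_proof (\<tau> n) ls \<and> length ls \<le> d * n ^ l + d" for n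
  proof -
    obtain gs :: "(nat, 'a) gate list" where gs: "circ_wf gs" "weakly_skew gs"
        "length gs \<le> c * n ^ k + c" "circ_poly gs = cert_poly (\<tau> n)" using ck[of n] by blast
    have "unsat_cnf (\<tau> n)" using \<tau> by (simp add: taut_family_def)
    then obtain ls :: "(nat, 'a) mpoly list" where ls: "PC_proof (\<tau> n) ls"
        "length ls \<le> 2 * cnf_size (\<tau> n) * (length gs + 2) + 3"
      by (rule PC_proof_of_weakly_skew_circuit[OF _ gs(1,2,4)])
    have "2 * cnf_size (\<tau> n) * (length gs + 2) \<le> 2 * cnf_size (\<tau> n) * ((c * n ^ k + c) + 2)"
      using gs(3) by (intro mult_le_mono2) simp
    with ls dl[of n] show ?thesis by (intro exI[of _ ls]) linarith
  qed
  then show ?thesis by blast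
qed

text \<open>All three parts are contrapositives of the two preceding bounds; the degree clauses
  express that proof families have polynomial degree.\<close>

theorem theorem3p1:
  shows
   "((\<exists>\<tau>. taut_family \<tau> \<and>
        \<not> (\<exists>c k. \<forall>n. \<exists>gs :: (ivar, 'a::comm_ring_1) gate list.
              hilbert_IPS_proof False (\<tau> n) gs \<and> length gs \<le> c * n ^ k + c \<and>
              mpoly_deg (circ_poly gs) \<le> c * n ^ k + c))
      \<longrightarrow> (VNP_class False :: (nat \<Rightarrow> (nat, 'a) mpoly) set) \<noteq> VP_class False)
  \<and> ((\<exists>\<tau>. taut_family \<tau> \<and>
        \<not> (\<exists>c k. \<forall>n. \<exists>gs :: (ivar, 'a) gate list.
              hilbert_IPS_proof True (\<tau> n) gs \<and> length gs \<le> c * n ^ k + c \<and>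
              mpoly_deg (circ_poly gs) \<le> c * n ^ k + c))
      \<longrightarrow> (VNP_class True :: (nat \<Rightarrow> (nat, 'a) mpoly) set) \<noteq> VP_class True)
  \<and> ((\<exists>\<tau>. taut_family \<tau> \<and>
        \<not> (\<exists>c k. \<forall>n. \<exists>ls :: (nat, 'b::field) mpoly list.
              PC_proof (\<tau> n) ls \<and> length ls \<le> c * n ^ k + c))
      \<longrightarrow> (VNP_class False :: (nat \<Rightarrow> (nat, 'b) mpoly) set) \<noteq> VPws_class)"
  using hilbert_IPS_poly_bounded[where 'a = 'a] PC_poly_bounded[where 'a = 'b] by blast

end
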